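(* Let $\lambda\in\mathbb{C}\setminus 2\mathbb{Z}$. Then $M_\lambda^C=U(I_\lambda)/U(I_\lambda)C$ is a simple $\mathbb{Z}_2^2$-graded $\mathfrak{sl}_2(\mathbb{C})$-module of rank $2$.
   Context: Let $x=\begin{bmatrix}0&1\\0&0\end{bmatrix}$, $h=\begin{bmatrix}1&0\\0&-1\end{bmatrix}$, $y=\begin{bmatrix}0&0\\1&0\end{bmatrix}$ be the standard basis of $\mathfrak{sl}_2(\mathbb{C})$ and put $B=x+y=\begin{bmatrix}0&1\\1&0\end{bmatrix}$, $C=x-y=\begin{bmatrix}0&1\\-1&0\end{bmatrix}$. Let $c=(h+1)^2+4yx\in U(\mathfrak{sl}_2(\mathbb{C}))$ be the Casimir element. For $\lambda\in\mathbb{C}$, let $I_\lambda$ be the two-sided ideal of $U(\mathfrak{sl}_2(\mathbb{C}))$ generated by the central element $c-(\lambda+1)^2$, and let $U(I_\lambda)=U(\mathfrak{sl}_2(\mathbb{C}))/I_\lambda$. $M_\lambda^C=U(I_\lambda)/U(I_\lambda)C$ is the quotient of the left regular module by the left ideal generated by the image of $C$. The Pauli grading of $\mathfrak{sl}_2(\mathbb{C})$ by $\mathbb{Z}_2^2$ is $L_{(1,0)}=\langle h\rangle$, $L_{(0,1)}=\langle B\rangle$, $L_{(1,1)}=\langle C\rangle$. It extends uniquely to a $\mathbb{Z}_2^2$-grading of the associative algebra $U(\mathfrak{sl}_2(\mathbb{C}))$, and the $\mathbb{Z}_2^2$-grading on $M_\lambda^C$ is the one induced by passing to quotients. A $\mathbb{Z}_2^2$-graded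 $\mathfrak{sl}_2(\mathbb{C})$-module is a module $M=\bigoplus_{g\in\mathbb{Z}_2^2}M_g$ with $L_gM_k\subset M_{g+k}$ for all $g,k$, where $L=\mathfrak{sl}_2(\mathbb{C})$ carries the Pauli grading. An $\mathfrak{sl}_2(\mathbb{C})$-module has rank $n$ if, as a $\mathbb{C}[h]$-module, it is free of rank $n$ (such modules are called torsion-free of rank $n$). *)

theory Defs
  imports
    "HOL-Analysis.Determinants"
    "HOL-Analysis.Product_Vector"
    "HOL-Computational_Algebra.Polynomial"
    "HOL-Library.Poly_Mapping"
    "HOL-Library.Z2"
    "HOL-Algebra.Module"
    "HOL-Algebra.QuotRing"
begin

definition ring_of_type :: "'a::ring_1 ring" where
  "ring_of_type = \<lparr>carrier = UNIV, mult = (*), one = 1, zero = 0, add = (+)\<rparr>"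

abbreviation complex_ring :: "complex ring" where
  "complex_ring \<equiv> ring_of_type"

abbreviation complex_poly_ring :: "complex poly ring" where
  "complex_poly_ring \<equiv> ring_of_type"


section \<open>The Lie algebra and its Pauli grading\<close>

definition sl2 :: "(complex^2^2) set" where
  "sl2 = {A. trace A = 0}"

definition lie_bracket :: "complex^2^2 \<Rightarrow> complex^2^2 \<Rightarrow> complex^2^2" where
  "lie_bracket A B = A ** B - B ** A"

text \<open>The scalar multiple \<open>k A\<close> of a matrix is rendered as \<^term>\<open>mat k ** A\<close>.\<close>

definition sl2_x :: "complex^2^2" where
  "sl2_x = vector [vector [0, 1], vector [0, 0]]"

definition sl2_h :: "complex^2^2" where
  "sl2_h = vector [vector [1, 0], vector [0, -1]]"

definition sl2_y :: "complex^2^2" where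
  "sl2_y = vector [vector [0, 0], vector [1, 0]]"

definition sl2_B :: "complex^2^2" where
  "sl2_B = sl2_x + sl2_y"

definition sl2_C :: "complex^2^2" where
  "sl2_C = sl2_x - sl2_y"

definition pauli :: "bit \<times> bit \<Rightarrow> (complex^2^2) set" where
  "pauli g =
    (if g = (1, 0) then {mat k ** sl2_h | k. True}
     else if g = (0, 1) then {mat k ** sl2_B | k. True}
     else if g = (1, 1) then {mat k ** sl2_C | k. True}
     else {0})"


section \<open>Modules over the Lie algebra\<close>

locale sl2_module = module complex_ring M
  for M :: "(complex, 'm) module" (structure) +
  fixes act :: "complex^2^2 \<Rightarrow> 'm \<Rightarrow> 'm"
  assumes act_closed: "\<lbrakk>a \<in> sl2; m \<in> carrier M\<rbrakk> \<Longrightarrow> act a m \<in> carrier M"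
    and act_add_left: "\<lbrakk>a \<in> sl2; b \<in> sl2; m \<in> carrier M\<rbrakk> \<Longrightarrow>
      act (a + b) m = act a m \<oplus>\<^bsub>M\<^esub> act b m"
    and act_scale_left: "\<lbrakk>a \<in> sl2; m \<in> carrier M\<rbrakk> \<Longrightarrow>
      act (mat k ** a) m = k \<odot>\<^bsub>M\<^esub> act a m"
    and act_add_right: "\<lbrakk>a \<in> sl2; m \<in> carrier M; n \<in> carrier M\<rbrakk> \<Longrightarrow>
      act a (m \<oplus>\<^bsub>M\<^esub> n) = act a m \<oplus>\<^bsub>M\<^esub> act a n"
    and act_scale_right: "\<lbrakk>a \<in> sl2; m \<in> carrier M\<rbrakk> \<Longrightarrow>
      act a (k \<odot>\<^bsub>M\<^esub> m) = k \<odot>\<^bsub>M\<^esub> act a m"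
    and act_bracket: "\<lbrakk>a \<in> sl2; b \<in> sl2; m \<in> carrier M\<rbrakk> \<Longrightarrow>
      act (lie_bracket a b) m = act a (act b m) \<ominus>\<^bsub>M\<^esub> act b (act a m)"

definition sl2_submodule ::
    "'m set \<Rightarrow> (complex, 'm) module \<Rightarrow> (complex^2^2 \<Rightarrow> 'm \<Rightarrow> 'm) \<Rightarrow> bool" where
  "sl2_submodule N M act \<longleftrightarrow>
    submodule N complex_ring M \<and> (\<forall>a\<in>sl2. \<forall>m\<in>N. act a m \<in> N)"

definition simple_sl2_module ::
    "(complex, 'm) module \<Rightarrow> (complex^2^2 \<Rightarrow> 'm \<Rightarrow> 'm) \<Rightarrow> bool" where
  "simple_sl2_module M act \<longleftrightarrow>
    sl2_module M act \<and> carrier M \<noteq> {\<zero>\<^bsub>M\<^esub>} \<and>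
    (\<forall>N. sl2_submodule N M act \<longrightarrow> N = {\<zero>\<^bsub>M\<^esub>} \<or> N = carrier M)"

definition graded_sl2_module ::
    "(complex, 'm) module \<Rightarrow> (complex^2^2 \<Rightarrow> 'm \<Rightarrow> 'm) \<Rightarrow> (bit \<times> bit \<Rightarrow> 'm set) \<Rightarrow> bool"
  where
  "graded_sl2_module M act \<Gamma> \<longleftrightarrow>
    sl2_module M act \<and>
    (\<forall>g. submodule (\<Gamma> g) complex_ring M) \<and>
    (\<forall>m\<in>carrier M. \<exists>!f. (\<forall>g. f g \<in> \<Gamma> g) \<and> m = (\<Oplus>\<^bsub>M\<^esub>g\<in>UNIV. f g)) \<and>
    (\<forall>g k. \<forall>a\<in>pauli g. \<forall>m\<in>\<Gamma> k. act a m \<in> \<Gamma> (g + k))"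

definition free_module_of_rank ::
    "('r, 'a) ring_scheme \<Rightarrow> ('r, 'm) module \<Rightarrow> nat \<Rightarrow> bool" where
  "free_module_of_rank R M n \<longleftrightarrow>
    module R M \<and>
    (\<exists>E. E \<subseteq> carrier M \<and> finite E \<and> card E = n \<and>
      (\<forall>m\<in>carrier M. \<exists>!c. c \<in> E \<rightarrow>\<^sub>E carrier R \<and> m = (\<Oplus>\<^bsub>M\<^esub>e\<in>E. c e \<odot>\<^bsub>M\<^esub> e)))"

text \<open>The \<open>\<complex>[h]\<close>-module underlying an \<open>sl\<^sub>2\<close>-module: \<open>p(h) m = \<Sum>\<^sub>i p\<^sub>i h\<^sup>i m\<close>.
  The fields \<^const>\<open>mult\<close> and \<^const>\<open>one\<close> of a module record carry no meaning.\<close>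

definition h_module ::
    "(complex, 'm) module \<Rightarrow> (complex^2^2 \<Rightarrow> 'm \<Rightarrow> 'm) \<Rightarrow> (complex poly, 'm) module" where
  "h_module M act =
    \<lparr>carrier = carrier M, mult = mult M, one = one M, zero = zero M, add = add M,
     smult = (\<lambda>p m. \<Oplus>\<^bsub>M\<^esub>i\<in>{..degree p}. coeff p i \<odot>\<^bsub>M\<^esub> (act sl2_h ^^ i) m)\<rparr>"

definition sl2_module_rank ::
    "(complex, 'm) module \<Rightarrow> (complex^2^2 \<Rightarrow> 'm \<Rightarrow> 'm) \<Rightarrow> nat \<Rightarrow> bool" where
  "sl2_module_rank M act n \<longleftrightarrow>
    sl2_module M act \<and> free_module_of_rank complex_poly_ring (h_module M act) n"


section \<open>The universal enveloping algebra\<close>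

text \<open>Words form the free monoid under concatenation, so finitely supported functions on
  words, with the convolution product of \<^type>\<open>poly_mapping\<close>, form the free associative
  algebra.\<close>

instantiation list :: (type) monoid_add
begin

definition zero_list :: "'a list" where
  "zero_list = []"

definition plus_list :: "'a list \<Rightarrow> 'a list \<Rightarrow> 'a list" where
  "plus_list = (@)"

instance
  by standard (simp_all add: zero_list_def plus_list_def)

end

type_synonym sl2_free = "(complex^2^2) list \<Rightarrow>\<^sub>0 complex"

definition free_algebra :: "sl2_free ring" where
  "free_algebra = ring_of_type\<lparr>carrier := {p. \<forall>w\<in>Poly_Mapping.keys p. set w \<subseteq> sl2}\<rparr>"

definition gen :: "complex^2^2 \<Rightarrow> sl2_free" where
  "gen a = Poly_Mapping.single [a] 1"

definition scal :: "complex \<Rightarrow> sl2_free" where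
  "scal k = Poly_Mapping.single [] k"

text \<open>The letters of the free algebra are all elements of \<^const>\<open>sl2\<close>; the first two
  families of relations make \<^const>\<open>gen\<close> linear, so that imposing them alone gives the
  tensor algebra of \<^const>\<open>sl2\<close>.\<close>

definition uea_relations :: "sl2_free set" where
  "uea_relations =
    {gen (a + b) - (gen a + gen b) | a b. a \<in> sl2 \<and> b \<in> sl2} \<union>
    {gen (mat k ** a) - scal k * gen a | k a. a \<in> sl2} \<union>
    {gen a * gen b - gen b * gen a - gen (lie_bracket a b) | a b. a \<in> sl2 \<and> b \<in> sl2}"

definition uea_ideal :: "sl2_free set" where
  "uea_ideal = Idl\<^bsub>free_algebra\<^esub> uea_relations"

definition uea :: "sl2_free set ring" where
  "uea = free_algebra Quot uea_ideal"

definition uea_class :: "sl2_free \<Rightarrow> sl2_free set" where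
  "uea_class p = uea_ideal +>\<^bsub>free_algebra\<^esub> p"

definition uea_incl :: "complex^2^2 \<Rightarrow> sl2_free set" where
  "uea_incl a = uea_class (gen a)"

definition uea_const :: "complex \<Rightarrow> sl2_free set" where
  "uea_const k = uea_class (scal k)"

text \<open>The component of degree \<open>g\<close> of the extension of the Pauli grading is spanned by the
  products \<open>a\<^sub>1 \<cdots> a\<^sub>n\<close> of homogeneous elements of \<^const>\<open>sl2\<close> whose degrees add up
  to \<open>g\<close>. Every algebra grading extending the Pauli grading has a component of degree \<open>g\<close>
  containing this span, and hence equal to it, as these spans add up to the whole algebra.\<close>

definition free_component :: "bit \<times> bit \<Rightarrow> sl2_free set" where
  "free_component g =
    {p. \<forall>w\<in>Poly_Mapping.keys p. \<exists>gs. list_all2 (\<lambda>a d. a \<in> pauli d) w gs \<and> sum_list gs = g}"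

definition uea_component :: "bit \<times> bit \<Rightarrow> sl2_free set set" where
  "uea_component g = uea_class ` free_component g"


section \<open>The quotient by a central character\<close>

definition casimir :: "sl2_free set" where
  "casimir =
    (uea_incl sl2_h \<oplus>\<^bsub>uea\<^esub> \<one>\<^bsub>uea\<^esub>) [^]\<^bsub>uea\<^esub> (2::nat) \<oplus>\<^bsub>uea\<^esub>
    uea_const 4 \<otimes>\<^bsub>uea\<^esub> (uea_incl sl2_y \<otimes>\<^bsub>uea\<^esub> uea_incl sl2_x)"

definition I_ideal :: "complex \<Rightarrow> sl2_free set set" where
  "I_ideal lam = Idl\<^bsub>uea\<^esub> {casimir \<ominus>\<^bsub>uea\<^esub> uea_const ((lam + 1)\<^sup>2)}"

definition U_I :: "complex \<Rightarrow> sl2_free set set ring" where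
  "U_I lam = uea Quot I_ideal lam"

definition U_I_class :: "complex \<Rightarrow> sl2_free set \<Rightarrow> sl2_free set set" where
  "U_I_class lam u = I_ideal lam +>\<^bsub>uea\<^esub> u"


section \<open>The module \<open>U(I\<^sub>\<lambda>) / U(I\<^sub>\<lambda>) C\<close>\<close>

text \<open>\<^const>\<open>cgenideal\<close> consists of the left multiples of its generator, so in this
  noncommutative ring it is the principal left ideal.\<close>

definition MC_left_ideal :: "complex \<Rightarrow> sl2_free set set set" where
  "MC_left_ideal lam = PIdl\<^bsub>U_I lam\<^esub> (U_I_class lam (uea_incl sl2_C))"

definition MC_class :: "complex \<Rightarrow> sl2_free set set \<Rightarrow> sl2_free set set set" where
  "MC_class lam v = MC_left_ideal lam +>\<^bsub>U_I lam\<^esub> v"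

text \<open>Left multiplication of the coset \<open>m\<close> by \<open>u\<close>; as in \<^const>\<open>rcoset_mult\<close>, the
  union is over equal cosets.\<close>

definition MC_mult ::
    "complex \<Rightarrow> sl2_free set set \<Rightarrow> sl2_free set set set \<Rightarrow> sl2_free set set set" where
  "MC_mult lam u m = (\<Union>v\<in>m. MC_class lam (u \<otimes>\<^bsub>U_I lam\<^esub> v))"

definition MC :: "complex \<Rightarrow> (complex, sl2_free set set set) module" where
  "MC lam =
    \<lparr>carrier = a_rcosets\<^bsub>U_I lam\<^esub> (MC_left_ideal lam), mult = undefined, one = undefined,
     zero = MC_left_ideal lam, add = set_add (U_I lam),
     smult = (\<lambda>k. MC_mult lam (U_I_class lam (uea_const k)))\<rparr>"

definition MC_act ::
    "complex \<Rightarrow> complex^2^2 \<Rightarrow> sl2_free set set set \<Rightarrow> sl2_free set set set" where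
  "MC_act lam a = MC_mult lam (U_I_class lam (uea_incl a))"

definition MC_component :: "complex \<Rightarrow> bit \<times> bit \<Rightarrow> sl2_free set set set set" where
  "MC_component lam g = (\<lambda>u. MC_class lam (U_I_class lam u)) ` uea_component g"

end

theory Submission
  imports Defs
begin

text \<open>Put \<open>\<mu> = \<lambda> / 2\<close>. The module is identified with the space with basis \<open>e\<^sub>n\<close>,
  \<open>n \<in> \<int>\<close>, on which \<open>C e\<^sub>n = 2 \<i> n e\<^sub>n\<close> and \<open>h \<plusminus> \<i> B\<close> sends \<open>e\<^sub>n\<close> to
  \<open>2 (\<mu> \<mp> n) e\<^bsub>n\<plusminus>1\<^esub>\<close>; the class of \<open>1\<close> corresponds to \<open>e\<^sub>0\<close>. As \<open>\<mu>\<close> is not an integer no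
  coefficient vanishes, so the module is simple, and \<open>e\<^sub>0, e\<^sub>1\<close> is a basis over \<open>\<complex>[h]\<close> because the
  vectors \<open>h\<^sup>k e\<^sub>0, h\<^sup>k e\<^sub>1\<close> are triangular with respect to the \<open>e\<^sub>n\<close>. The grading is given by the parity of
  \<open>n\<close> and the symmetry \<open>n \<mapsto> - n\<close>. The evaluation \<open>u \<mapsto> u e\<^sub>0\<close> kills the Casimir relation and the left
  ideal of \<open>C\<close>. That it has no larger kernel is seen without the Poincare-Birkhoff-Witt theorem: modulo
  these relations the powers of \<open>h \<plusminus> \<i> B\<close>, suitably rescaled, satisfy the same ladder relations as the
  \<open>e\<^sub>n\<close> and hence provide a section of the evaluation through which the class of \<open>u\<close> factors.\<close>

text \<open>The scalars are dictated by the Casimir element. For \<open>H = - \<i> C\<close>,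
  \<open>X = h + \<i> B\<close>, \<open>Y = h - \<i> B\<close> it becomes
  \<open>Y X + (H + 1)^2\<close>. On a vector with \<open>H\<close>-eigenvalue \<open>2 n\<close>
  the central relation therefore forces \<open>Y X\<close> to be
  \<open>(lam + 1)^2 - (2 n + 1)^2 = (lam - 2 n) (lam + 2 n + 2)\<close>. Only this product is
  forced; giving the first factor to \<open>X\<close> at \<open>n\<close> and the second to
  \<open>Y\<close> at \<open>n + 1\<close> makes the reflection \<open>n -> - n\<close> exchange
  \<open>X\<close> and \<open>Y\<close>. Hence \<open>h\<close> commutes with the reflection while
  \<open>B\<close> and \<open>C\<close> anticommute with it, and the Pauli degrees can be read off
  from signs. The obstacle in bounding the kernel is an asymmetry: the defining relations of the
  algebra may be followed by any word, but \<open>C\<close> vanishes only as the last factor of a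
  product. The computations in the free algebra therefore run modulo a left ideal, and a congruence
  that has to be multiplied from the right must hold modulo the smaller two-sided
  annihilator.\<close>

abbreviation coef :: "('a \<Rightarrow>\<^sub>0 'b::zero) \<Rightarrow> 'a \<Rightarrow> 'b" where
  "coef \<equiv> Poly_Mapping.lookup"


section \<open>The weight module of an element conjugate to \<open>h\<close>\<close>

type_synonym weight_space = "int \<Rightarrow>\<^sub>0 complex"

lift_definition wscale :: "complex \<Rightarrow> weight_space \<Rightarrow> weight_space" is "\<lambda>c v n. c * v n"
  by (rule finite_subset[rotated]) auto

lift_definition raise :: "complex \<Rightarrow> weight_space \<Rightarrow> weight_space" is
  "\<lambda>\<mu> v n. (\<mu> - of_int (n - 1)) * v (n - 1)"
proof -
  fix \<mu> :: complex and v :: "int \<Rightarrow> complex"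
  assume f: "finite {n. v n \<noteq> 0}"
  have "{n. (\<mu> - of_int (n - 1)) * v (n - 1) \<noteq> 0} \<subseteq> (\<lambda>n. n + 1) ` {n. v n \<noteq> 0}"
    by (auto intro!: image_eqI[where x = "_ - 1"])
  then show "finite {n. (\<mu> - of_int (n - 1)) * v (n - 1) \<noteq> 0}"
    using f finite_subset by blast
qed

lift_definition lower :: "complex \<Rightarrow> weight_space \<Rightarrow> weight_space" is
  "\<lambda>\<mu> v n. (\<mu> + of_int (n + 1)) * v (n + 1)"
proof -
  fix \<mu> :: complex and v :: "int \<Rightarrow> complex"
  assume f: "finite {n. v n \<noteq> 0}"
  have "{n. (\<mu> + of_int (n + 1)) * v (n + 1) \<noteq> 0} \<subseteq> (\<lambda>n. n - 1) ` {n. v n \<noteq> 0}"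
    by (auto intro!: image_eqI[where x = "_ + 1"])
  then show "finite {n. (\<mu> + of_int (n + 1)) * v (n + 1) \<noteq> 0}"
    using f finite_subset by blast
qed

lift_definition weight :: "weight_space \<Rightarrow> weight_space" is "\<lambda>v n. of_int n * v n"
  by (rule finite_subset[rotated]) auto

lemmas lookup_ops = wscale.rep_eq raise.rep_eq lower.rep_eq weight.rep_eq
  lookup_add lookup_minus lookup_uminus lookup_zero

definition basis_vec :: "int \<Rightarrow> weight_space" where
  "basis_vec n = Poly_Mapping.single n 1"

lemma coef_basis_vec: "coef (basis_vec n) k = (if k = n then 1 else 0)"
  by (simp add: basis_vec_def lookup_single when_def)

text \<open>The scalars are the coordinates of \<open>a\<close> in the basis \<open>h\<close>,
  \<open>B\<close>, \<open>C\<close>, up to the factors \<open>\<i>\<close> and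
  \<open>2 * \<i>\<close> with which \<open>B\<close> and \<open>C\<close> act. As
  \<open>a $ 2 $ 2\<close> does not occur, the formula is linear on all matrices; the bracket law is
  where trace zero enters.\<close>

definition wact :: "complex \<Rightarrow> complex^2^2 \<Rightarrow> weight_space \<Rightarrow> weight_space" where
  "wact \<mu> a v =
    wscale (a $ 1 $ 1) (raise \<mu> v + lower \<mu> v) +
    wscale (\<i> * (a $ 1 $ 2 + a $ 2 $ 1) / 2) (lower \<mu> v - raise \<mu> v) +
    wscale (\<i> * (a $ 1 $ 2 - a $ 2 $ 1)) (weight v)"

lemma wact_add_left: "wact \<mu> (a + b) v = wact \<mu> a v + wact \<mu> b v"
  by (rule poly_mapping_eqI) (simp add: wact_def lookup_ops field_simps)

lemma mat_mult_nth: "(mat k ** a) $ i $ j = k * a $ i $ j"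
  for a :: "complex^2^2"
  by (simp add: matrix_matrix_mult_def mat_def if_distrib[of "\<lambda>x. x * _"] cong: if_cong)

lemma wact_scale_left: "wact \<mu> (mat k ** a) v = wscale k (wact \<mu> a v)"
  by (rule poly_mapping_eqI) (simp add: wact_def lookup_ops mat_mult_nth field_simps)

lemma wact_add_right: "wact \<mu> a (u + v) = wact \<mu> a u + wact \<mu> a v"
  by (rule poly_mapping_eqI) (simp add: wact_def lookup_ops field_simps)

lemma wact_scale_right: "wact \<mu> a (wscale k v) = wscale k (wact \<mu> a v)"
  by (rule poly_mapping_eqI) (simp add: wact_def lookup_ops field_simps)

lemma wact_zero [simp]: "wact \<mu> a 0 = 0"
  by (rule poly_mapping_eqI) (simp add: wact_def lookup_ops)

lemma sl2_iff: "a \<in> sl2 \<longleftrightarrow> a $ 2 $ 2 = - a $ 1 $ 1"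
  by (auto simp: sl2_def trace_def sum_2 add_eq_0_iff)

lemma lookup_wact: "coef (wact \<mu> a v) n =
   a $ 1 $ 1 * ((\<mu> - of_int n + 1) * coef v (n - 1) + (\<mu> + of_int n + 1) * coef v (n + 1)) +
   \<i> * (a $ 1 $ 2 + a $ 2 $ 1) / 2 * ((\<mu> + of_int n + 1) * coef v (n + 1) - (\<mu> - of_int n + 1) * coef v (n - 1)) +
   \<i> * (a $ 1 $ 2 - a $ 2 $ 1) * of_int n * coef v n"
  unfolding wact_def lookup_ops by (simp add: algebra_simps)

lemma wact_bracket:
  assumes "a \<in> sl2" "b \<in> sl2"
  shows "wact \<mu> (lie_bracket a b) v = wact \<mu> a (wact \<mu> b v) - wact \<mu> b (wact \<mu> a v)"
proof (rule poly_mapping_eqI)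
  fix n :: int
  have [simp]: "a $ 2 $ 2 = - a $ 1 $ 1" "b $ 2 $ 2 = - b $ 1 $ 1"
    using assms by (simp_all add: sl2_iff)
  have [simp]: "n - 1 - 1 = n - 2" "n + 1 + 1 = n + 2" by simp_all
  \<comment> \<open>Coordinates with respect to \<open>h\<close>, \<open>B\<close>,
    \<open>C\<close>. In them the bracket follows from \<open>[h, B] = 2 C\<close>,
    \<open>[h, C] = 2 B\<close>, \<open>[C, B] = 2 h\<close>, and the claim becomes a polynomial
    identity.\<close>
  define p q r where "p = a $ 1 $ 1" "q = (a $ 1 $ 2 + a $ 2 $ 1) / 2" "r = (a $ 1 $ 2 - a $ 2 $ 1) / 2"
  define p' q' r' where "p' = b $ 1 $ 1" "q' = (b $ 1 $ 2 + b $ 2 $ 1) / 2" "r' = (b $ 1 $ 2 - b $ 2 $ 1) / 2"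
  have e: "a $ 1 $ 1 = p" "a $ 1 $ 2 = q + r" "a $ 2 $ 1 = q - r"
    "b $ 1 $ 1 = p'" "b $ 1 $ 2 = q' + r'" "b $ 2 $ 1 = q' - r'"
    by (simp_all add: p_q_r_def p'_q'_r'_def field_simps)
  have c: "lie_bracket a b $ 1 $ 1 = 2 * (r * q' - q * r')"
     "lie_bracket a b $ 1 $ 2 + lie_bracket a b $ 2 $ 1 = 4 * (p * r' - r * p')"
     "lie_bracket a b $ 1 $ 2 - lie_bracket a b $ 2 $ 1 = 4 * (p * q' - q * p')"
    by (simp_all add: lie_bracket_def matrix_matrix_mult_def sum_2 e algebra_simps)
  have c': "q + r + (q - r) = 2 * q" "q + r - (q - r) = 2 * r" 
    "q' + r' + (q' - r') = 2 * q'" "q' + r' - (q' - r') = 2 * r'"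
    by simp_all
  have h: "\<i> * (2 * x) / 2 = \<i> * x" "\<i> * (4 * x) / 2 = \<i> * (2 * x)" for x
    by simp_all
  have ii: "\<i> * (\<i> * x) = - x" for x
    by (simp flip: mult.assoc)
  show "coef (wact \<mu> (lie_bracket a b) v) n =
      coef (wact \<mu> a (wact \<mu> b v) - wact \<mu> b (wact \<mu> a v)) n"
    unfolding lookup_minus lookup_wact c e c' h
    by (simp add: algebra_simps ii)
qed

interpretation ws: vector_space wscale
  by unfold_locales (auto intro!: poly_mapping_eqI simp: lookup_ops algebra_simps)

section \<open>The generators of the Lie algebra on the basis vectors\<close>

lemma poly_mapping_expansion:
  "p = (\<Sum>k\<in>Poly_Mapping.keys p. Poly_Mapping.single k (coef p k))"
  by (rule poly_mapping_eqI)
    (auto simp: lookup_sum lookup_single when_def in_keys_iff)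

lemma wscale_basis_vec: "wscale c (basis_vec n) = Poly_Mapping.single n c"
  by (rule poly_mapping_eqI) (simp add: lookup_ops coef_basis_vec lookup_single when_def)

lemma weight_expansion:
  "v = (\<Sum>n\<in>Poly_Mapping.keys v. wscale (coef v n) (basis_vec n))"
  unfolding wscale_basis_vec by (rule poly_mapping_expansion)

lemma wact_sl2_h: "wact \<mu> sl2_h v = raise \<mu> v + lower \<mu> v"
  by (simp add: wact_def sl2_h_def vector_2)

lemma wact_sl2_B: "wact \<mu> sl2_B v = wscale \<i> (lower \<mu> v - raise \<mu> v)"
  by (simp add: wact_def sl2_B_def sl2_x_def sl2_y_def vector_2)

lemma wact_sl2_C: "wact \<mu> sl2_C v = wscale (2 * \<i>) (weight v)"
  by (simp add: wact_def sl2_C_def sl2_x_def sl2_y_def vector_2 mult.commute)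

lemma sl2_generators [simp]: "sl2_x \<in> sl2" "sl2_y \<in> sl2" "sl2_h \<in> sl2" "sl2_B \<in> sl2" "sl2_C \<in> sl2"
  by (simp_all add: sl2_iff sl2_x_def sl2_y_def sl2_h_def sl2_B_def sl2_C_def vector_2)

lemma ii_mult: "\<i> * (\<i> * x) = - x"
  by (simp flip: mult.assoc)

text \<open>As combinations of actions of Lie algebra elements, the ladder operators preserve every
  invariant subspace.\<close>

lemma raise_via_act: "raise \<mu> v = wscale (1/2) (wact \<mu> sl2_h v + wscale \<i> (wact \<mu> sl2_B v))"
  unfolding wact_sl2_h wact_sl2_B
  by (rule poly_mapping_eqI, simp only: lookup_ops, simp add: algebra_simps ii_mult)

lemma lower_via_act: "lower \<mu> v = wscale (1/2) (wact \<mu> sl2_h v - wscale \<i> (wact \<mu> sl2_B v))"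
  unfolding wact_sl2_h wact_sl2_B
  by (rule poly_mapping_eqI, simp only: lookup_ops, simp add: algebra_simps ii_mult)

lemma raise_basis_vec: "raise \<mu> (basis_vec n) = wscale (\<mu> - of_int n) (basis_vec (n + 1))"
  by (rule poly_mapping_eqI) (auto simp: lookup_ops coef_basis_vec)

lemma lower_basis_vec: "lower \<mu> (basis_vec n) = wscale (\<mu> + of_int n) (basis_vec (n - 1))"
  by (rule poly_mapping_eqI) (auto simp: lookup_ops coef_basis_vec)

lemma weight_basis_vec: "weight (basis_vec n) = wscale (of_int n) (basis_vec n)"
  by (rule poly_mapping_eqI) (auto simp: lookup_ops coef_basis_vec)

section \<open>Irreducibility of the weight module\<close>

definition invariant_subspace :: "complex \<Rightarrow> weight_space set \<Rightarrow> bool" where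
  "invariant_subspace \<mu> N \<longleftrightarrow> ws.subspace N \<and> (\<forall>a\<in>sl2. \<forall>v\<in>N. wact \<mu> a v \<in> N)"

lemma subspace_all_basis_vec:
  assumes "ws.subspace N" "\<And>n. basis_vec n \<in> N"
  shows "N = UNIV"
proof -
  have "v \<in> N" for v
    by (subst weight_expansion) (intro ws.subspace_sum ws.subspace_scale assms)
  then show ?thesis by auto
qed

text \<open>A nonzero element of minimal support is a weight vector, since otherwise \<open>C\<close> minus one of
  its eigenvalues shortens it.\<close>

lemma invariant_subspace_eq_UNIV:
  assumes \<mu>: "\<mu> \<notin> \<int>" and N: "invariant_subspace \<mu> N" and v: "v \<in> N" "v \<noteq> 0"
  shows "N = UNIV"
proof -
  have sub: "ws.subspace N" and act: "\<And>a v. a \<in> sl2 \<Longrightarrow> v \<in> N \<Longrightarrow> wact \<mu> a v \<in> N"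
    using N by (auto simp: invariant_subspace_def)
  note cl = ws.subspace_scale[OF sub] ws.subspace_add[OF sub] ws.subspace_diff[OF sub]
  obtain u where u: "u \<in> N" "u \<noteq> 0"
    and min: "\<And>w. w \<in> N \<Longrightarrow> w \<noteq> 0 \<Longrightarrow> card (Poly_Mapping.keys u) \<le> card (Poly_Mapping.keys w)"
    using ex_has_least_nat[of "\<lambda>w. w \<in> N \<and> w \<noteq> 0" v "\<lambda>w. card (Poly_Mapping.keys w)"] v by auto
  obtain m where m: "m \<in> Poly_Mapping.keys u"
    using u(2) by (metis keys_eq_empty ex_in_conv)
  have "n = m" if n: "n \<in> Poly_Mapping.keys u" for n
  proof (rule ccontr)
    assume "n \<noteq> m"
    define w where "w = wact \<mu> sl2_C u - wscale (2 * \<i> * of_int m) u"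
    have w: "coef w k = 2 * \<i> * (of_int k - of_int m) * coef u k" for k
      by (simp add: w_def wact_sl2_C lookup_ops algebra_simps)
    have "w \<in> N" unfolding w_def by (intro cl act u sl2_generators)
    moreover have "coef w n \<noteq> 0" using n \<open>n \<noteq> m\<close> by (simp add: w in_keys_iff)
    then have "w \<noteq> 0" by auto
    moreover have "Poly_Mapping.keys w \<subset> Poly_Mapping.keys u"
      using m by (auto simp: in_keys_iff w)
    then have "card (Poly_Mapping.keys w) < card (Poly_Mapping.keys u)"
      by (intro psubset_card_mono) auto
    ultimately show False using min[of w] by simp
  qed
  then have "Poly_Mapping.keys u = {m}" using m by blast
  then have "wscale (coef u m) (basis_vec m) = u"
    using weight_expansion[of u, symmetric] by simp
  then have "wscale (1 / coef u m) u = wscale (1 / coef u m) (wscale (coef u m) (basis_vec m))"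
    by (simp only:)
  also have "\<dots> = basis_vec m"
    using m by (simp add: in_keys_iff)
  finally have "wscale (1 / coef u m) u = basis_vec m" .
  then have m0: "basis_vec m \<in> N" using cl(1)[OF u(1), of "1 / coef u m"] by simp
  have nz: "\<mu> - of_int n \<noteq> 0" "\<mu> + of_int n \<noteq> 0" for n
    using \<mu> by (auto simp: add_eq_0_iff2)
  have up: "basis_vec (n + 1) \<in> N" if "basis_vec n \<in> N" for n
  proof -
    have "raise \<mu> (basis_vec n) \<in> N"
      unfolding raise_via_act by (intro cl act that sl2_generators)
    then have "wscale (1 / (\<mu> - of_int n)) (raise \<mu> (basis_vec n)) \<in> N" by (rule cl)
    then show ?thesis using nz(1)[of n] by (simp add: raise_basis_vec)
  qed
  have down: "basis_vec (n - 1) \<in> N" if "basis_vec n \<in> N" for n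
  proof -
    have "lower \<mu> (basis_vec n) \<in> N"
      unfolding lower_via_act by (intro cl act that sl2_generators)
    then have "wscale (1 / (\<mu> + of_int n)) (lower \<mu> (basis_vec n)) \<in> N" by (rule cl)
    then show ?thesis using nz(2)[of n] by (simp add: lower_basis_vec)
  qed
  have "basis_vec n \<in> N" for n
    by (induction n rule: int_induct[of _ m]) (auto intro: m0 up down)
  then show ?thesis by (rule subspace_all_basis_vec[OF sub])
qed

section \<open>Freeness over the polynomials in \<open>h\<close>\<close>

definition poly_act :: "complex \<Rightarrow> complex poly \<Rightarrow> weight_space \<Rightarrow> weight_space" where
  "poly_act \<mu> p v = (\<Sum>i\<le>degree p. wscale (coeff p i) ((wact \<mu> sl2_h ^^ i) v))"

lemma poly_act_bound:
  "degree p \<le> n \<Longrightarrow> poly_act \<mu> p v = (\<Sum>i\<le>n. wscale (coeff p i) ((wact \<mu> sl2_h ^^ i) v))"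
  unfolding poly_act_def
  by (rule sum.mono_neutral_left) (auto simp: coeff_eq_0)

lemma poly_act_0 [simp]: "poly_act \<mu> 0 v = 0"
  by (simp add: poly_act_def)

lemma poly_act_1 [simp]: "poly_act \<mu> 1 v = v"
  by (simp add: poly_act_def)

lemma poly_act_add: "poly_act \<mu> (p + q) v = poly_act \<mu> p v + poly_act \<mu> q v"
proof -
  let ?n = "max (degree p) (degree q)"
  show ?thesis
    by (simp add: poly_act_bound[of _ ?n] degree_add_le ws.scale_left_distrib sum.distrib)
qed

lemma poly_act_smult: "poly_act \<mu> (Polynomial.smult c p) v = wscale c (poly_act \<mu> p v)"
  by (simp add: poly_act_bound[of _ "degree p"] degree_smult_le ws.scale_sum_right)

lemma poly_act_diff: "poly_act \<mu> (p - q) v = poly_act \<mu> p v - poly_act \<mu> q v"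
  using poly_act_add[of \<mu> p "- q" v] poly_act_smult[of \<mu> "- 1" q v] by simp

lemma wact_sum: "wact \<mu> a (\<Sum>i\<in>A. f i) = (\<Sum>i\<in>A. wact \<mu> a (f i))"
  by (induction A rule: infinite_finite_induct) (auto simp: wact_add_right)

text \<open>The Horner step: it gives multiplicativity by induction on the polynomial, in place of a
  manipulation of double sums.\<close>

lemma poly_act_pCons: "poly_act \<mu> (pCons c p) v = wscale c v + wact \<mu> sl2_h (poly_act \<mu> p v)"
proof -
  have "poly_act \<mu> (pCons c p) v =
      (\<Sum>i\<le>Suc (degree p). wscale (coeff (pCons c p) i) ((wact \<mu> sl2_h ^^ i) v))"
    by (rule poly_act_bound[OF degree_pCons_le])
  also have "\<dots> = wscale c v + (\<Sum>i\<le>degree p. wscale (coeff p i) ((wact \<mu> sl2_h ^^ Suc i) v))"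
    by (subst sum.atMost_Suc_shift) (simp only: coeff_pCons_0 coeff_pCons_Suc funpow_0)
  also have "\<dots> = wscale c v + wact \<mu> sl2_h (poly_act \<mu> p v)"
    by (simp add: poly_act_def wact_sum wact_scale_right)
  finally show ?thesis .
qed

lemma poly_act_mult: "poly_act \<mu> (p * q) v = poly_act \<mu> p (poly_act \<mu> q v)"
  by (induction p) (simp_all add: poly_act_pCons poly_act_add poly_act_smult)

lemma wact_pow_add: "(wact \<mu> a ^^ i) (u + v) = (wact \<mu> a ^^ i) u + (wact \<mu> a ^^ i) v"
  by (induction i) (simp_all add: wact_add_right)

lemma poly_act_add_right: "poly_act \<mu> p (u + v) = poly_act \<mu> p u + poly_act \<mu> p v"
  by (simp add: poly_act_def wact_pow_add ws.scale_right_distrib sum.distrib)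

lemma coef_wact_h: "coef (wact \<mu> sl2_h v) n =
    (\<mu> - of_int (n - 1)) * coef v (n - 1) + (\<mu> + of_int (n + 1)) * coef v (n + 1)"
  by (simp add: wact_sl2_h lookup_ops)

text \<open>One application of \<open>h\<close> moves the support by one in either
  direction.\<close>

lemma coef_wact_h_pow_basis_vec:
  "\<bar>n - m\<bar> > int k \<Longrightarrow> coef ((wact \<mu> sl2_h ^^ k) (basis_vec m)) n = 0"
proof (induction k arbitrary: n)
  case 0
  then show ?case by (auto simp: coef_basis_vec)
next
  case (Suc k)
  then have "\<bar>(n - 1) - m\<bar> > int k" "\<bar>(n + 1) - m\<bar> > int k" by linarith+
  then show ?case by (simp only: funpow.simps o_apply coef_wact_h Suc.IH) simp
qed

text \<open>Only the path that raises (or lowers) at every step reaches the outermost weight, so the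
  coefficient there is a product of factors \<open>\<mu> - n\<close> (or \<open>\<mu> + n\<close>)
  with integers \<open>n\<close>.\<close>

lemma coef_wact_h_pow_basis_vec_nz:
  assumes "\<mu> \<notin> \<int>"
  shows "coef ((wact \<mu> sl2_h ^^ k) (basis_vec m)) (m + int k) \<noteq> 0"
    "coef ((wact \<mu> sl2_h ^^ k) (basis_vec m)) (m - int k) \<noteq> 0"
proof -
  have nz: "\<mu> - of_int n \<noteq> 0" "\<mu> + of_int n \<noteq> 0" for n
    using assms by (auto simp: add_eq_0_iff2)
  show "coef ((wact \<mu> sl2_h ^^ k) (basis_vec m)) (m + int k) \<noteq> 0"
  proof (induction k)
    case 0
    show ?case by (simp add: coef_basis_vec)
  next
    case (Suc k)
    \<comment> \<open>The neighbour further out lies beyond the support, so one term of the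
      recursion survives.\<close>
    have "coef ((wact \<mu> sl2_h ^^ k) (basis_vec m)) (m + int (Suc k) + 1) = 0"
      by (rule coef_wact_h_pow_basis_vec) simp
    moreover have "m + int (Suc k) - 1 = m + int k" by simp
    ultimately show ?case using Suc nz(1)[of "m + int k"]
      by (simp only: funpow.simps o_apply coef_wact_h) simp
  qed
  show "coef ((wact \<mu> sl2_h ^^ k) (basis_vec m)) (m - int k) \<noteq> 0"
  proof (induction k)
    case 0
    show ?case by (simp add: coef_basis_vec)
  next
    case (Suc k)
    have "coef ((wact \<mu> sl2_h ^^ k) (basis_vec m)) (m - int (Suc k) - 1) = 0"
      by (rule coef_wact_h_pow_basis_vec) simp
    moreover have "m - int (Suc k) + 1 = m - int k" by simp
    ultimately show ?case using Suc nz(2)[of "m - int k"]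
      by (simp only: funpow.simps o_apply coef_wact_h) simp
  qed
qed

lemma coef_poly_act_basis_vec:
  "\<bar>n - m\<bar> > int (degree p) \<Longrightarrow> coef (poly_act \<mu> p (basis_vec m)) n = 0"
  by (simp add: poly_act_def lookup_sum lookup_ops coef_wact_h_pow_basis_vec)

text \<open>Lower powers of \<open>h\<close> do not reach distance \<open>degree p\<close>; what
  remains is the leading coefficient of \<open>p\<close> times a nonzero number.\<close>

lemma coef_poly_act_basis_vec_nz:
  assumes "\<mu> \<notin> \<int>" "p \<noteq> 0" "n = m + int (degree p) \<or> n = m - int (degree p)"
  shows "coef (poly_act \<mu> p (basis_vec m)) n \<noteq> 0"
proof -
  have "coef (poly_act \<mu> p (basis_vec m)) n =
      (\<Sum>i\<le>degree p. coeff p i * coef ((wact \<mu> sl2_h ^^ i) (basis_vec m)) n)"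
    by (simp add: poly_act_def lookup_sum lookup_ops)
  also have "\<dots> = (\<Sum>i\<in>{degree p}. coeff p i * coef ((wact \<mu> sl2_h ^^ i) (basis_vec m)) n)"
    using assms(3) by (intro sum.mono_neutral_right) (auto intro!: coef_wact_h_pow_basis_vec)
  also have "\<dots> \<noteq> 0"
    using coef_wact_h_pow_basis_vec_nz[OF assms(1)] assms(2,3) by auto
  finally show ?thesis .
qed

text \<open>In the order \<open>0, 1, -1, 2, -2, \<dots>\<close> of the weights the family
  \<open>h\<^sup>k e\<^sub>0, h\<^sup>k e\<^sub>1\<close> is triangular.\<close>

lemma poly_act_independent:
  assumes \<mu>: "\<mu> \<notin> \<int>" and eq: "poly_act \<mu> p (basis_vec 0) + poly_act \<mu> q (basis_vec 1) = 0"
  shows "p = 0 \<and> q = 0"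
proof (rule ccontr)
  assume ne: "\<not> (p = 0 \<and> q = 0)"
  have eq': "coef (poly_act \<mu> p (basis_vec 0)) n + coef (poly_act \<mu> q (basis_vec 1)) n = 0" for n
    using arg_cong[OF eq, of "\<lambda>v. coef v n"] by (simp add: lookup_ops)
  show False
  \<comment> \<open>Weight \<open>1 + degree q\<close> is out of reach for \<open>p\<close> acting
    on \<open>basis_vec 0\<close> if \<open>degree p \<le> degree q\<close>; otherwise
    \<open>- degree p\<close> is out of reach for \<open>q\<close> acting on
    \<open>basis_vec 1\<close>. A tie goes to \<open>q\<close>, whose starting point lies one step
    further to the right.\<close>
  proof (cases "q \<noteq> 0 \<and> degree p \<le> degree q")
    case True
    then have "coef (poly_act \<mu> p (basis_vec 0)) (1 + int (degree q)) = 0"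
      by (intro coef_poly_act_basis_vec) auto
    moreover have "coef (poly_act \<mu> q (basis_vec 1)) (1 + int (degree q)) \<noteq> 0"
      using True by (intro coef_poly_act_basis_vec_nz \<mu>) auto
    ultimately show False using eq'[of "1 + int (degree q)"] by simp
  next
    case False
    then have "p \<noteq> 0" using ne by auto
    then have "coef (poly_act \<mu> p (basis_vec 0)) (- int (degree p)) \<noteq> 0"
      by (intro coef_poly_act_basis_vec_nz \<mu>) auto
    moreover have "coef (poly_act \<mu> q (basis_vec 1)) (- int (degree p)) = 0"
      using False by (cases "q = 0") (auto intro!: coef_poly_act_basis_vec)
    ultimately show False using eq'[of "- int (degree p)"] by simp
  qed
qed

text \<open>The span is stable under \<open>h\<close>, and a window of weights contained in it can
  be widened: at an edge, \<open>h\<close> produces one vector outside the window, with a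
  coefficient that is nonzero because \<open>\<mu>\<close> is not an integer.\<close>

lemma poly_act_spans:
  assumes \<mu>: "\<mu> \<notin> \<int>"
  shows "\<exists>p q. v = poly_act \<mu> p (basis_vec 0) + poly_act \<mu> q (basis_vec 1)"
proof -
  define S where "S = {v. \<exists>p q. v = poly_act \<mu> p (basis_vec 0) + poly_act \<mu> q (basis_vec 1)}"
  have SI: "poly_act \<mu> p (basis_vec 0) + poly_act \<mu> q (basis_vec 1) \<in> S" for p q
    by (auto simp: S_def)
  have SE: "\<exists>p q. v = poly_act \<mu> p (basis_vec 0) + poly_act \<mu> q (basis_vec 1)" if "v \<in> S" for v
    using that by (simp add: S_def)
  have nz: "\<mu> - of_int n \<noteq> 0" "\<mu> + of_int n \<noteq> 0" for n
    using \<mu> by (auto simp: add_eq_0_iff2)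
  have S: "ws.subspace S"
  proof (rule ws.subspaceI)
    show "0 \<in> S" using SI[of 0 0] by simp
  next
    fix u v assume "u \<in> S" "v \<in> S"
    then obtain p q p' q' where "u = poly_act \<mu> p (basis_vec 0) + poly_act \<mu> q (basis_vec 1)"
      "v = poly_act \<mu> p' (basis_vec 0) + poly_act \<mu> q' (basis_vec 1)" using SE by meson
    then show "u + v \<in> S" using SI[of "p + p'" "q + q'"] by (simp add: poly_act_add algebra_simps)
  next
    fix c v assume "v \<in> S"
    then obtain p q where "v = poly_act \<mu> p (basis_vec 0) + poly_act \<mu> q (basis_vec 1)"
      using SE by meson
    then show "wscale c v \<in> S"
      using SI[of "Polynomial.smult c p" "Polynomial.smult c q"]
      by (simp add: poly_act_smult ws.scale_right_distrib)
  qed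
  note cl = ws.subspace_scale[OF S] ws.subspace_diff[OF S]
  have h: "wact \<mu> sl2_h v \<in> S" if "v \<in> S" for v
  proof -
    from that obtain p q where "v = poly_act \<mu> p (basis_vec 0) + poly_act \<mu> q (basis_vec 1)"
      using SE by meson
    then show ?thesis
      using SI[of "pCons 0 p" "pCons 0 q"] by (simp add: poly_act_pCons wact_add_right)
  qed
  have b: "basis_vec 0 \<in> S" "basis_vec 1 \<in> S"
    using SI[of 1 0] SI[of 0 1] by simp_all
  \<comment> \<open>The smallest window already contains \<open>0\<close> and \<open>1\<close>, so
    each edge has its inner neighbour in the window.\<close>
  have *: "basis_vec n \<in> S" if "- int k \<le> n" "n \<le> int k + 1" for k n
    using that
  proof (induction k arbitrary: n)
    case 0
    then have "n = 0 \<or> n = 1" by auto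
    then show ?case using b by auto
  next
    case (Suc k)
    let ?m = "int k + 1"
    have "basis_vec (?m + 1) = wscale (1 / (\<mu> - of_int ?m))
        (wact \<mu> sl2_h (basis_vec ?m) - wscale (\<mu> + of_int ?m) (basis_vec (?m - 1)))"
      using nz(1)[of ?m]
      by (simp add: wact_sl2_h raise_basis_vec lower_basis_vec del: of_int_add)
    moreover have "basis_vec ?m \<in> S" "basis_vec (?m - 1) \<in> S" by (simp_all add: Suc.IH)
    ultimately have up: "basis_vec (?m + 1) \<in> S"
      by (simp only:) (intro cl h)
    let ?m = "- int k"
    have "basis_vec (?m - 1) = wscale (1 / (\<mu> + of_int ?m))
        (wact \<mu> sl2_h (basis_vec ?m) - wscale (\<mu> - of_int ?m) (basis_vec (?m + 1)))"
      using nz(2)[of ?m]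
      by (simp add: wact_sl2_h raise_basis_vec lower_basis_vec del: of_int_minus)
    moreover have "basis_vec ?m \<in> S" "basis_vec (?m + 1) \<in> S" by (simp_all add: Suc.IH)
    ultimately have down: "basis_vec (?m - 1) \<in> S"
      by (simp only:) (intro cl h)
    have "(- int k \<le> n \<and> n \<le> int k + 1) \<or> n = int k + 1 + 1 \<or> n = - int k - 1"
      using Suc.prems by auto
    then show ?case using up down Suc.IH by auto
  qed
  have "basis_vec n \<in> S" for n
    by (rule *[of "nat \<bar>n\<bar>"]) auto
  then show ?thesis using subspace_all_basis_vec[OF S] SE by simp
qed

section \<open>The Pauli grading of the weight module\<close>

text \<open>A joint eigenspace of the commuting involutions \<open>e_n -> e_(-n)\<close> and
  \<open>e_n -> (-1)^n e_n\<close>. The reflection commutes with \<open>h\<close> and anticommutes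
  with \<open>B\<close> and \<open>C\<close>; parity is changed by \<open>h\<close> and
  \<open>B\<close> and kept by \<open>C\<close>. Matching this with the Pauli degrees makes
  \<open>snd g\<close> the sign of the reflection and \<open>fst g + snd g\<close> the
  parity.\<close>

definition weight_component :: "bit \<times> bit \<Rightarrow> weight_space set" where
  "weight_component g =
    {v. \<forall>n. coef v (- n) = (if snd g = 1 then - coef v n else coef v n) \<and>
      (coef v n \<noteq> 0 \<longrightarrow> (odd n \<longleftrightarrow> fst g \<noteq> snd g))}"

lemma subspace_weight_component: "ws.subspace (weight_component g)"
proof (rule ws.subspaceI)
  fix v w assume vw: "v \<in> weight_component g" "w \<in> weight_component g"
  have "odd n \<longleftrightarrow> fst g \<noteq> snd g" if "coef (v + w) n \<noteq> 0" for n
  proof -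
    have "coef v n \<noteq> 0 \<or> coef w n \<noteq> 0" using that by (auto simp: lookup_add)
    then show ?thesis using vw by (auto simp: weight_component_def)
  qed
  then show "v + w \<in> weight_component g"
    using vw by (simp add: weight_component_def lookup_add)
qed (auto simp: weight_component_def lookup_ops)

lemma basis_vec_0_component: "basis_vec 0 \<in> weight_component 0"
  by (auto simp: weight_component_def coef_basis_vec)

text \<open>The reflection \<open>n -> - n\<close> exchanges \<open>raise\<close> and
  \<open>lower\<close>, hence commutes with their sum.\<close>

lemma wact_h_component:
  assumes "v \<in> weight_component g" shows "wact \<mu> sl2_h v \<in> weight_component ((1, 0) + g)"
proof -
  have s: "coef v (- n) = (if snd g = 1 then - coef v n else coef v n)"
    and p: "coef v n \<noteq> 0 \<Longrightarrow> odd n \<longleftrightarrow> fst g \<noteq> snd g" for n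
    using assms by (auto simp: weight_component_def)
  have c: "coef v (- n - 1) = (if snd g = 1 then - coef v (n + 1) else coef v (n + 1))"
    "coef v (- n + 1) = (if snd g = 1 then - coef v (n - 1) else coef v (n - 1))" for n
  proof -
    have "- n - 1 = - (n + 1)" "- n + 1 = - (n - 1)" by simp_all
    then show "coef v (- n - 1) = (if snd g = 1 then - coef v (n + 1) else coef v (n + 1))"
      "coef v (- n + 1) = (if snd g = 1 then - coef v (n - 1) else coef v (n - 1))"
      by (simp_all only: s)
  qed
  have "coef (wact \<mu> sl2_h v) (- n) =
      (if snd g = 1 then - coef (wact \<mu> sl2_h v) n else coef (wact \<mu> sl2_h v) n)" for n
    unfolding coef_wact_h c by (simp add: algebra_simps)
  moreover have "odd n \<longleftrightarrow> fst g = snd g" if "coef (wact \<mu> sl2_h v) n \<noteq> 0" for n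
  proof -
    have "coef v (n - 1) \<noteq> 0 \<or> coef v (n + 1) \<noteq> 0" using that by (auto simp: coef_wact_h)
    then show ?thesis using p[of "n - 1"] p[of "n + 1"] by auto
  qed
  ultimately show ?thesis
    by (cases "fst g"; cases "snd g") (auto simp: weight_component_def)
qed

lemma coef_wact_B: "coef (wact \<mu> sl2_B v) n =
    \<i> * ((\<mu> + of_int (n + 1)) * coef v (n + 1) - (\<mu> - of_int (n - 1)) * coef v (n - 1))"
  by (simp add: wact_sl2_B lookup_ops)

text \<open>\<open>B\<close> acts as a multiple of \<open>lower - raise\<close>, which changes sign
  under conjugation by the reflection \<open>n -> - n\<close>.\<close>

lemma wact_B_component:
  assumes "v \<in> weight_component g" shows "wact \<mu> sl2_B v \<in> weight_component ((0, 1) + g)"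
proof -
  have s: "coef v (- n) = (if snd g = 1 then - coef v n else coef v n)"
    and p: "coef v n \<noteq> 0 \<Longrightarrow> odd n \<longleftrightarrow> fst g \<noteq> snd g" for n
    using assms by (auto simp: weight_component_def)
  have c: "coef v (- n - 1) = (if snd g = 1 then - coef v (n + 1) else coef v (n + 1))"
    "coef v (- n + 1) = (if snd g = 1 then - coef v (n - 1) else coef v (n - 1))" for n
  proof -
    have "- n - 1 = - (n + 1)" "- n + 1 = - (n - 1)" by simp_all
    then show "coef v (- n - 1) = (if snd g = 1 then - coef v (n + 1) else coef v (n + 1))"
      "coef v (- n + 1) = (if snd g = 1 then - coef v (n - 1) else coef v (n - 1))"
      by (simp_all only: s)
  qed
  have "coef (wact \<mu> sl2_B v) (- n) =
      (if snd g = 1 then coef (wact \<mu> sl2_B v) n else - coef (wact \<mu> sl2_B v) n)" for n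
    unfolding coef_wact_B c by (simp add: algebra_simps)
  moreover have "odd n \<longleftrightarrow> fst g = snd g" if "coef (wact \<mu> sl2_B v) n \<noteq> 0" for n
  proof -
    have "coef v (n - 1) \<noteq> 0 \<or> coef v (n + 1) \<noteq> 0" using that by (auto simp: coef_wact_B)
    then show ?thesis using p[of "n - 1"] p[of "n + 1"] by auto
  qed
  ultimately show ?thesis
    by (cases "fst g"; cases "snd g") (auto simp: weight_component_def)
qed

lemma wact_C_component:
  assumes "v \<in> weight_component g" shows "wact \<mu> sl2_C v \<in> weight_component ((1, 1) + g)"
  using assms unfolding weight_component_def wact_sl2_C
  by (cases "fst g"; cases "snd g") (auto simp: lookup_ops)

lemma pauli_cases:
  assumes "a \<in> pauli g"
  obtains "a = 0" | k where "g = (1, 0)" "a = mat k ** sl2_h"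
    | k where "g = (0, 1)" "a = mat k ** sl2_B" | k where "g = (1, 1)" "a = mat k ** sl2_C"
  using assms by (auto simp: pauli_def split: if_splits)

lemma wact_0_left [simp]: "wact \<mu> 0 v = 0"
  by (rule poly_mapping_eqI) (simp add: wact_def lookup_ops)

lemma wact_component:
  assumes "a \<in> pauli d" "v \<in> weight_component g"
  shows "wact \<mu> a v \<in> weight_component (d + g)"
  using assms(1)
proof (cases rule: pauli_cases)
  case 1
  then show ?thesis using ws.subspace_0[OF subspace_weight_component] by simp
next
  case 2
  show ?thesis unfolding 2 wact_scale_left
    by (intro ws.subspace_scale[OF subspace_weight_component] wact_h_component assms)
next
  case 3
  show ?thesis unfolding 3 wact_scale_left
    by (intro ws.subspace_scale[OF subspace_weight_component] wact_B_component assms)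
next
  case 4
  show ?thesis unfolding 4 wact_scale_left
    by (intro ws.subspace_scale[OF subspace_weight_component] wact_C_component assms)
qed

lemma UNIV_bit2: "(UNIV :: (bit \<times> bit) set) = {(0, 0), (0, 1), (1, 0), (1, 1)}"
  by (auto simp: UNIV_Times_UNIV[symmetric] simp del: UNIV_Times_UNIV intro: bit.exhaust)

lemma finite_bit2: "finite (UNIV :: (bit \<times> bit) set)"
  by (simp add: UNIV_bit2)

lemma sum_UNIV_bit2: "sum f (UNIV :: (bit \<times> bit) set) = f (0, 0) + f (0, 1) + f (1, 0) + f (1, 1)"
  for f :: "bit \<times> bit \<Rightarrow> 'a::comm_monoid_add"
  unfolding UNIV_bit2 by (simp add: add.assoc)

text \<open>At each weight parity leaves two of the four summands, one symmetric and one
  antisymmetric; comparing the coefficients at \<open>n\<close> and \<open>- n\<close> separates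
  these.\<close>

lemma weight_component_independent:
  assumes u: "\<And>g. u g \<in> weight_component g" and sum: "(\<Sum>g\<in>UNIV. u g) = 0"
  shows "u g = 0"
proof (rule poly_mapping_eqI)
  fix n
  have s: "coef (u g) (- n) = (if snd g = 1 then - coef (u g) n else coef (u g) n)"
    and p: "coef (u g) n \<noteq> 0 \<Longrightarrow> odd n \<longleftrightarrow> fst g \<noteq> snd g" for g n
    using u[of g] by (auto simp: weight_component_def)
  have "coef (\<Sum>g\<in>UNIV. u g) k = 0" for k using sum by simp
  then have z: "coef (u (0, 0)) k + coef (u (0, 1)) k + coef (u (1, 0)) k + coef (u (1, 1)) k = 0" for k
    by (simp add: sum_UNIV_bit2 lookup_add)
  have "coef (u (0, 0)) n = 0 \<and> coef (u (0, 1)) n = 0 \<and> coef (u (1, 0)) n = 0 \<and> coef (u (1, 1)) n = 0"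
    using z[of n] z[of "- n"] p[of "(0,0)" n] p[of "(0,1)" n] p[of "(1,0)" n] p[of "(1,1)" n]
      s[of "(0,0)" n] s[of "(0,1)" n] s[of "(1,0)" n] s[of "(1,1)" n]
    by (cases "odd n") (auto simp: add_eq_0_iff)
  then show "coef (u g) n = coef 0 n"
    by (cases g; cases "fst g"; cases "snd g") auto
qed

lemma wact_generators:
  "wact \<mu> a v = wscale (a $ 1 $ 1) (wact \<mu> sl2_h v) + wscale ((a $ 1 $ 2 + a $ 2 $ 1) / 2) (wact \<mu> sl2_B v)
    + wscale ((a $ 1 $ 2 - a $ 2 $ 1) / 2) (wact \<mu> sl2_C v)"
  unfolding wact_sl2_h wact_sl2_B wact_sl2_C
  by (simp add: wact_def mult.commute)

lemma pauli_generators: "sl2_h \<in> pauli (1, 0)" "sl2_B \<in> pauli (0, 1)" "sl2_C \<in> pauli (1, 1)"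
  by (auto simp: pauli_def intro!: exI[of _ 1])

text \<open>The sum of the \<open>N g\<close> is invariant and contains \<open>basis_vec 0\<close>,
  so irreducibility makes it the whole space. The family is abstract because it will consist of the
  images of the homogeneous components of the free algebra, for which these closure properties are
  immediate.\<close>

lemma graded_subspaces_span:
  assumes \<mu>: "\<mu> \<notin> \<int>" and N: "\<And>g. ws.subspace (N g)"
    and act: "\<And>d g a v. a \<in> pauli d \<Longrightarrow> v \<in> N g \<Longrightarrow> wact \<mu> a v \<in> N (d + g)"
    and b: "basis_vec 0 \<in> N 0"
  shows "\<exists>u. (\<forall>g. u g \<in> N g) \<and> v = (\<Sum>g\<in>UNIV. u g)"
proof -
  define S where "S = {v. \<exists>u. (\<forall>g. u g \<in> N g) \<and> v = (\<Sum>g\<in>UNIV. u g)}"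
  have SI: "(\<Sum>g\<in>UNIV. u g) \<in> S" if "\<And>g. u g \<in> N g" for u
    using that by (auto simp: S_def)
  have SE: "\<exists>u. (\<forall>g. u g \<in> N g) \<and> v = (\<Sum>g\<in>UNIV. u g)" if "v \<in> S" for v
    using that by (simp add: S_def)
  have S: "ws.subspace S"
  proof (rule ws.subspaceI)
    show "0 \<in> S" using SI[of "\<lambda>_. 0"] ws.subspace_0[OF N] by simp
  next
    fix v w assume "v \<in> S" "w \<in> S"
    then obtain f f' where f: "\<forall>g. f g \<in> N g" "v = (\<Sum>g\<in>UNIV. f g)"
      and f': "\<forall>g. f' g \<in> N g" "w = (\<Sum>g\<in>UNIV. f' g)" using SE by meson
    have "(\<Sum>g\<in>UNIV. f g + f' g) \<in> S" using f f' by (intro SI ws.subspace_add[OF N]) auto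
    then show "v + w \<in> S" by (simp add: f(2) f'(2) sum.distrib)
  next
    fix c v assume "v \<in> S"
    then obtain f where f: "\<forall>g. f g \<in> N g" "v = (\<Sum>g\<in>UNIV. f g)" using SE by meson
    have "(\<Sum>g\<in>UNIV. wscale c (f g)) \<in> S" using f by (intro SI ws.subspace_scale[OF N]) auto
    then show "wscale c v \<in> S" by (simp add: f(2) ws.scale_sum_right)
  qed
  have homog: "wact \<mu> a v \<in> S" if a: "a \<in> pauli d" and v: "v \<in> S" for a d v
  proof -
    from v obtain f where f: "\<forall>g. f g \<in> N g" "v = (\<Sum>g\<in>UNIV. f g)" using SE by meson
    \<comment> \<open>The part of degree \<open>g\<close> in the image comes from degree
      \<open>g - d\<close>, hence the reindexing by a shift.\<close>
    have "wact \<mu> a (f (g - d)) \<in> N g" for g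
      using act[OF a, of "f (g - d)" "g - d"] f(1) by simp
    then have "(\<Sum>g\<in>UNIV. wact \<mu> a (f (g - d))) \<in> S" by (rule SI)
    also have "(\<Sum>g\<in>UNIV. wact \<mu> a (f (g - d))) = (\<Sum>g\<in>UNIV. wact \<mu> a (f g))"
      by (rule sum.reindex_bij_witness[of _ "\<lambda>g. g + d" "\<lambda>g. g - d"]) auto
    finally show ?thesis by (simp add: f(2) wact_sum)
  qed
  have "wact \<mu> a v \<in> S" if v: "v \<in> S" for a v
    unfolding wact_generators[of \<mu> a]
    by (intro ws.subspace_add[OF S] ws.subspace_scale[OF S]
        homog[OF pauli_generators(1) v] homog[OF pauli_generators(2) v] homog[OF pauli_generators(3) v])
  then have inv: "invariant_subspace \<mu> S" using S by (simp add: invariant_subspace_def)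
  have "(\<Sum>g\<in>UNIV. if g = (0 :: bit \<times> bit) then basis_vec 0 else 0) \<in> S"
    by (rule SI) (use b ws.subspace_0[OF N] in auto)
  then have "basis_vec 0 \<in> S" by (simp add: finite_bit2)
  moreover have "basis_vec 0 \<noteq> 0"
    using coef_basis_vec[of 0 0] by (metis lookup_zero one_neq_zero)
  ultimately have "S = UNIV" using invariant_subspace_eq_UNIV[OF \<mu> inv] by blast
  then show ?thesis using SE by blast
qed

section \<open>Modules isomorphic to the weight module\<close>

lemma cring_ring_of_type: "cring (ring_of_type :: 'a::comm_ring_1 ring)"
proof (intro cringI abelian_groupI comm_monoidI)
  fix x :: 'a
  show "\<exists>y\<in>carrier ring_of_type. y \<oplus>\<^bsub>ring_of_type\<^esub> x = \<zero>\<^bsub>ring_of_type\<^esub>"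
    by (auto simp: ring_of_type_def intro: exI[of _ "- x"])
qed (auto simp: ring_of_type_def algebra_simps)

lemma ring_of_type_sel [simp]:
  "carrier ring_of_type = UNIV" "mult ring_of_type = (*)" "one ring_of_type = 1"
  "zero ring_of_type = 0" "add ring_of_type = (+)"
  by (simp_all add: ring_of_type_def)

text \<open>Transport of structure along a surjection that preserves addition; \<open>G\<close> may
  be a bare record whose group laws are not yet known.\<close>

lemma abelian_group_range:
  fixes G (structure) and \<psi> :: "'a::ab_group_add \<Rightarrow> 'b"
  assumes "carrier G = range \<psi>" "\<zero> = \<psi> 0" "\<And>u v. \<psi> u \<oplus> \<psi> v = \<psi> (u + v)"
  shows "abelian_group G"
proof (rule abelian_groupI)
  fix x assume "x \<in> carrier G"
  then obtain v where "x = \<psi> v" by (auto simp: assms)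
  then have "\<psi> (- v) \<oplus> x = \<zero>" by (simp add: assms)
  then show "\<exists>y\<in>carrier G. y \<oplus> x = \<zero>" by (auto simp: assms)
qed (auto simp: assms algebra_simps)

lemma finsum_range:
  fixes G (structure) and \<psi> :: "'a::ab_group_add \<Rightarrow> 'b"
  assumes G: "carrier G = range \<psi>" "\<zero> = \<psi> 0" "\<And>u v. \<psi> u \<oplus> \<psi> v = \<psi> (u + v)"
    and "finite A"
  shows "(\<Oplus>i\<in>A. \<psi> (f i)) = \<psi> (\<Sum>i\<in>A. f i)"
proof -
  interpret abelian_group G by (rule abelian_group_range[OF G])
  show ?thesis using \<open>finite A\<close>
  proof (induction A rule: finite_induct)
    case (insert i A)
    have "(\<lambda>i. \<psi> (f i)) \<in> A \<rightarrow> carrier G" "\<psi> (f i) \<in> carrier G" by (auto simp: G)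
    then show ?case using insert by (simp add: G)
  qed (simp add: G)
qed

lemma sl2_add [simp]: "a \<in> sl2 \<Longrightarrow> b \<in> sl2 \<Longrightarrow> a + b \<in> sl2"
  by (simp add: sl2_iff)

lemma sl2_mat_mult [simp]: "a \<in> sl2 \<Longrightarrow> mat k ** a \<in> sl2"
  by (simp add: sl2_iff mat_mult_nth)

lemma sl2_lie_bracket [simp]: "lie_bracket a b \<in> sl2"
  by (simp add: sl2_iff lie_bracket_def matrix_matrix_mult_def sum_2)

lemma sl2_pauli: "a \<in> pauli g \<Longrightarrow> a \<in> sl2"
  by (elim pauli_cases) (auto simp: sl2_iff[of 0])

text \<open>Only formulas for the operations on values of \<open>\<psi>\<close> are required, and
  the module laws are derived from them. This fits a record of cosets with operations defined on
  sets.\<close>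

locale weight_space_copy =
  fixes \<mu> :: complex and M :: "(complex, 'm) module" (structure)
    and act :: "complex^2^2 \<Rightarrow> 'm \<Rightarrow> 'm" and \<psi> :: "weight_space \<Rightarrow> 'm"
  assumes carrier: "carrier M = range \<psi>" and inj: "inj \<psi>"
    and zero: "\<zero>\<^bsub>M\<^esub> = \<psi> 0" and add: "\<psi> u \<oplus>\<^bsub>M\<^esub> \<psi> v = \<psi> (u + v)"
    and smult: "c \<odot>\<^bsub>M\<^esub> \<psi> v = \<psi> (wscale c v)"
    and act: "a \<in> sl2 \<Longrightarrow> act a (\<psi> v) = \<psi> (wact \<mu> a v)"
begin

lemma abelian_group: "abelian_group M"
  by (rule abelian_group_range[OF carrier zero add])

sublocale M: abelian_group M
  by (rule abelian_group)

lemma is_module: "module complex_ring M"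
  by (rule moduleI)
    (auto simp: carrier add smult abelian_group cring_ring_of_type ws.scale_left_distrib ws.scale_right_distrib)

lemma a_inv: "\<ominus>\<^bsub>M\<^esub> \<psi> v = \<psi> (- v)"
  by (rule M.minus_equality) (auto simp: carrier add zero)

lemma a_minus: "\<psi> u \<ominus>\<^bsub>M\<^esub> \<psi> v = \<psi> (u - v)"
  by (simp add: a_minus_def a_inv add)

lemmas finsum = finsum_range[OF carrier zero add]

lemma is_sl2_module: "sl2_module M act"
proof -
  interpret module complex_ring M by (rule is_module)
  show ?thesis
    by unfold_locales
      (auto simp: carrier add smult act a_minus wact_add_left wact_scale_left wact_add_right
        wact_scale_right wact_bracket)
qed

lemma simple:
  assumes \<mu>: "\<mu> \<notin> \<int>"
  shows "simple_sl2_module M act"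
proof -
  interpret module complex_ring M by (rule is_module)
  have "basis_vec 0 \<noteq> 0"
    by (simp add: basis_vec_def)
  then have "\<psi> (basis_vec 0) \<noteq> \<psi> 0" using inj by (auto dest: injD)
  then have "carrier M \<noteq> {\<zero>\<^bsub>M\<^esub>}" by (auto simp: carrier zero)
  moreover have "N = {\<zero>\<^bsub>M\<^esub>} \<or> N = carrier M" if N: "sl2_submodule N M act" for N
  proof -
    have sub: "submodule N complex_ring M" and a: "\<And>a m. a \<in> sl2 \<Longrightarrow> m \<in> N \<Longrightarrow> act a m \<in> N"
      using N by (auto simp: sl2_submodule_def)
    note sub' = submoduleE[OF sub]
    obtain x where x: "x \<in> N" using sub'(2) by auto
    have "\<ominus>\<^bsub>M\<^esub> x \<oplus>\<^bsub>M\<^esub> x \<in> N" using x by (intro sub'(5) sub'(3))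
    then have z: "\<psi> 0 \<in> N" using x sub'(1) by (simp add: M.l_neg subset_iff zero)
    have "invariant_subspace \<mu> (\<psi> -` N)"
      unfolding invariant_subspace_def
    proof (intro conjI ws.subspaceI ballI; unfold vimage_eq)
      show "\<psi> 0 \<in> N" by (rule z)
    next
      fix u v assume "\<psi> u \<in> N" "\<psi> v \<in> N"
      then show "\<psi> (u + v) \<in> N" by (simp only: sub'(5) flip: add)
    next
      fix c v assume "\<psi> v \<in> N"
      then show "\<psi> (wscale c v) \<in> N" using sub'(4)[of c "\<psi> v"] by (simp add: smult)
    next
      fix b v assume "b \<in> sl2" "\<psi> v \<in> N"
      then show "\<psi> (wact \<mu> b v) \<in> N" by (simp only: a flip: act)
    qed
    note inv = invariant_subspace_eq_UNIV[OF \<mu> this]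
    show ?thesis
    proof (cases "\<exists>v. v \<noteq> 0 \<and> \<psi> v \<in> N")
      case True
      then have "\<psi> -` N = UNIV" using inv by blast
      then have "range \<psi> \<subseteq> N" by blast
      then show ?thesis using sub'(1) unfolding carrier by blast
    next
      case False
      have "x = \<psi> 0" if x: "x \<in> N" for x
      proof -
        obtain v where v: "x = \<psi> v" using x sub'(1) by (auto simp: carrier)
        then show ?thesis using False x by (cases "v = 0") auto
      qed
      then have "N = {\<psi> 0}" using z by blast
      then show ?thesis by (simp add: zero)
    qed
  qed
  ultimately show ?thesis using is_sl2_module by (auto simp: simple_sl2_module_def)
qed

text \<open>Existence of the decomposition comes from the closure of the family under the action,
  starting at \<open>basis_vec 0\<close>; uniqueness comes from its containment in the independent
  spaces \<open>weight_component g\<close>.\<close>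

lemma graded:
  assumes \<mu>: "\<mu> \<notin> \<int>" and N: "\<And>g. ws.subspace (N g)"
    and act_N: "\<And>d g a v. a \<in> pauli d \<Longrightarrow> v \<in> N g \<Longrightarrow> wact \<mu> a v \<in> N (d + g)"
    and b: "basis_vec 0 \<in> N 0" and sub: "\<And>g. N g \<subseteq> weight_component g"
    and \<Gamma>: "\<And>g. \<Gamma> g = \<psi> ` N g"
  shows "graded_sl2_module M act \<Gamma>"
  unfolding graded_sl2_module_def
proof (intro conjI allI ballI)
  interpret module complex_ring M by (rule is_module)
  show "sl2_module M act" by (rule is_sl2_module)
  show "submodule (\<Gamma> g) complex_ring M" for g
    by (rule submoduleI)
      (auto simp: \<Gamma> carrier zero a_inv add smult intro!: imageI ws.subspace_0[OF N]
        ws.subspace_neg[OF N] ws.subspace_add[OF N] ws.subspace_scale[OF N])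
next
  fix g k a m assume "a \<in> pauli g" "m \<in> \<Gamma> k"
  moreover from this have "a \<in> sl2" by (auto intro: sl2_pauli)
  moreover obtain v where "v \<in> N k" "m = \<psi> v" using \<open>m \<in> \<Gamma> k\<close> by (auto simp: \<Gamma>)
  ultimately show "act a m \<in> \<Gamma> (g + k)"
    using imageI[OF act_N, of a g v k \<psi>] by (simp only: \<Gamma> act)
next
  fix m assume "m \<in> carrier M"
  then obtain v where v: "m = \<psi> v" by (auto simp: carrier)
  obtain u where u: "\<And>g. u g \<in> N g" "v = (\<Sum>g\<in>UNIV. u g)"
    using graded_subspaces_span[OF \<mu> N act_N b, where v = v] by blast
  show "\<exists>!f. (\<forall>g. f g \<in> \<Gamma> g) \<and> m = (\<Oplus>\<^bsub>M\<^esub>g\<in>UNIV. f g)"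
  proof (rule ex1I[of _ "\<lambda>g. \<psi> (u g)"])
    show "(\<forall>g. \<psi> (u g) \<in> \<Gamma> g) \<and> m = (\<Oplus>\<^bsub>M\<^esub>g\<in>UNIV. \<psi> (u g))"
      using u by (auto simp: \<Gamma> v finsum finite_bit2)
  next
    fix f assume f: "(\<forall>g. f g \<in> \<Gamma> g) \<and> m = (\<Oplus>\<^bsub>M\<^esub>g\<in>UNIV. f g)"
    then have "\<forall>g. \<exists>w. w \<in> N g \<and> f g = \<psi> w" by (auto simp: \<Gamma>)
    then obtain w where w: "\<And>g. w g \<in> N g" and fw: "f = (\<lambda>g. \<psi> (w g))" by metis
    have "\<psi> v = \<psi> (\<Sum>g\<in>UNIV. w g)" using f by (simp add: v fw finsum finite_bit2)
    then have "(\<Sum>g\<in>UNIV. u g) = (\<Sum>g\<in>UNIV. w g)" using inj u(2) by (auto dest: injD)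
    then have "(\<Sum>g\<in>UNIV. u g - w g) = 0" by (simp add: sum_subtractf)
    moreover have "u g - w g \<in> weight_component g" for g
      by (intro ws.subspace_diff[OF subspace_weight_component] subsetD[OF sub] u(1) w)
    ultimately have "u g - w g = 0" for g
      using weight_component_independent[of "\<lambda>g. u g - w g"] by blast
    then show "f = (\<lambda>g. \<psi> (u g))" by (simp add: fw)
  qed
qed

lemma act_h_pow: "(act sl2_h ^^ i) (\<psi> v) = \<psi> ((wact \<mu> sl2_h ^^ i) v)"
  by (induction i) (simp_all add: act)

lemma h_module_smult: "p \<odot>\<^bsub>h_module M act\<^esub> \<psi> v = \<psi> (poly_act \<mu> p v)"
  by (simp add: h_module_def poly_act_def act_h_pow smult finsum)

lemma h_module_sel [simp]:
  "carrier (h_module M act) = carrier M" "zero (h_module M act) = zero M"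
  "add (h_module M act) = add M"
  by (simp_all add: h_module_def)

lemma h_module: "module complex_poly_ring (h_module M act)"
proof (rule moduleI)
  show "abelian_group (h_module M act)"
    by (rule abelian_group_range[of _ \<psi>]) (simp_all add: carrier zero add)
qed (auto simp: cring_ring_of_type carrier h_module_smult add poly_act_add poly_act_add_right poly_act_mult)

lemma rank_2:
  assumes \<mu>: "\<mu> \<notin> \<int>"
  shows "sl2_module_rank M act 2"
proof -
  define e0 e1 where "e0 = \<psi> (basis_vec 0)" and "e1 = \<psi> (basis_vec 1)"
  have "basis_vec 0 \<noteq> basis_vec 1"
    using coef_basis_vec[of 0 0] coef_basis_vec[of 1 0] by auto
  then have ne: "e0 \<noteq> e1" using inj by (auto simp: e0_def e1_def dest: injD)
  have sum: "(\<Oplus>\<^bsub>h_module M act\<^esub>e\<in>{e0, e1}. c e \<odot>\<^bsub>h_module M act\<^esub> e) =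
      \<psi> (poly_act \<mu> (c e0) (basis_vec 0) + poly_act \<mu> (c e1) (basis_vec 1))" for c
  proof -
    interpret H: module complex_poly_ring "h_module M act" by (rule h_module)
    have "c e0 \<odot>\<^bsub>h_module M act\<^esub> e0 \<in> carrier M" "c e1 \<odot>\<^bsub>h_module M act\<^esub> e1 \<in> carrier M"
      by (auto simp: e0_def e1_def h_module_smult carrier)
    then show ?thesis
      using ne by (simp add: H.finsum_insert) (simp add: e0_def e1_def h_module_smult add zero)
  qed
  have "\<exists>!c. c \<in> {e0, e1} \<rightarrow>\<^sub>E carrier complex_poly_ring \<and>
      m = (\<Oplus>\<^bsub>h_module M act\<^esub>e\<in>{e0, e1}. c e \<odot>\<^bsub>h_module M act\<^esub> e)" if m: "m \<in> carrier M" for m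
  proof -
    obtain v where v: "m = \<psi> v" using m by (auto simp: carrier)
    obtain p q where pq: "v = poly_act \<mu> p (basis_vec 0) + poly_act \<mu> q (basis_vec 1)"
      using poly_act_spans[OF \<mu>] by blast
    \<comment> \<open>Restricted to \<open>{e0, e1}\<close>, since uniqueness is asked among
      extensional functions.\<close>
    define c where "c = (\<lambda>e\<in>{e0, e1}. if e = e0 then p else q)"
    have cc: "c e0 = p" "c e1 = q" using ne by (auto simp: c_def)
    show ?thesis
    proof (rule ex1I[of _ c])
      show "c \<in> {e0, e1} \<rightarrow>\<^sub>E carrier complex_poly_ring \<and>
          m = (\<Oplus>\<^bsub>h_module M act\<^esub>e\<in>{e0, e1}. c e \<odot>\<^bsub>h_module M act\<^esub> e)"
        unfolding sum cc v pq by (auto simp: c_def)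
    next
      fix d assume d: "d \<in> {e0, e1} \<rightarrow>\<^sub>E carrier complex_poly_ring \<and>
          m = (\<Oplus>\<^bsub>h_module M act\<^esub>e\<in>{e0, e1}. d e \<odot>\<^bsub>h_module M act\<^esub> e)"
      then have "v = poly_act \<mu> (d e0) (basis_vec 0) + poly_act \<mu> (d e1) (basis_vec 1)"
        unfolding sum v by (auto dest: injD[OF inj])
      then have "poly_act \<mu> (p - d e0) (basis_vec 0) + poly_act \<mu> (q - d e1) (basis_vec 1) = 0"
        by (simp add: pq poly_act_diff flip: add_diff_add)
      then have "p - d e0 = 0 \<and> q - d e1 = 0"
        using poly_act_independent[OF \<mu>, of "p - d e0" "q - d e1"] by simp
      then have "d x = c x" if "x \<in> {e0, e1}" for x using that ne by (auto simp: c_def)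
      then show "d = c"
        using d by (intro PiE_ext[of d "{e0, e1}" "\<lambda>_. carrier complex_poly_ring" c]) (auto simp: c_def)
    qed
  qed
  moreover have "{e0, e1} \<subseteq> carrier M" "card {e0, e1} = 2" "finite {e0, e1}"
    using ne by (auto simp: e0_def e1_def carrier)
  ultimately show ?thesis
    unfolding sl2_module_rank_def free_module_of_rank_def h_module_sel
    by (intro conjI is_sl2_module h_module exI[of _ "{e0, e1}"]) auto
qed

end

section \<open>Evaluation of the free algebra on the weight module\<close>

text \<open>The representation of the free algebra extending \<open>wact\<close>. With
  \<open>foldr\<close> the rightmost letter acts first, so concatenation of words becomes
  composition of operators.\<close>

definition evaluate :: "complex \<Rightarrow> sl2_free \<Rightarrow> weight_space \<Rightarrow> weight_space" where
  "evaluate \<mu> p v = (\<Sum>w\<in>Poly_Mapping.keys p. wscale (coef p w) (foldr (wact \<mu>) w v))"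

lemma evaluate_superset:
  "finite S \<Longrightarrow> Poly_Mapping.keys p \<subseteq> S \<Longrightarrow>
    evaluate \<mu> p v = (\<Sum>w\<in>S. wscale (coef p w) (foldr (wact \<mu>) w v))"
  unfolding evaluate_def by (rule sum.mono_neutral_left) (auto simp: in_keys_iff)

lemma evaluate_zero [simp]: "evaluate \<mu> 0 v = 0"
  by (simp add: evaluate_def)

lemma evaluate_single: "evaluate \<mu> (Poly_Mapping.single w c) v = wscale c (foldr (wact \<mu>) w v)"
  by (simp add: evaluate_superset[of "{w}"])

lemma evaluate_gen [simp]: "evaluate \<mu> (gen a) v = wact \<mu> a v"
  by (simp add: gen_def evaluate_single)

lemma evaluate_scal [simp]: "evaluate \<mu> (scal k) v = wscale k v"
  by (simp add: scal_def evaluate_single)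

lemma scal_1: "scal 1 = 1"
  by (simp add: scal_def flip: zero_list_def)

lemma evaluate_one [simp]: "evaluate \<mu> 1 v = v"
  using evaluate_scal[of \<mu> 1 v] by (simp add: scal_1)

lemma evaluate_add: "evaluate \<mu> (p + q) v = evaluate \<mu> p v + evaluate \<mu> q v"
proof -
  let ?S = "Poly_Mapping.keys p \<union> Poly_Mapping.keys q"
  have "Poly_Mapping.keys (p + q) \<subseteq> ?S" by (rule keys_add)
  then show ?thesis
    by (simp add: evaluate_superset[of ?S] lookup_add ws.scale_left_distrib sum.distrib)
qed

lemma evaluate_uminus: "evaluate \<mu> (- p) v = - evaluate \<mu> p v"
  using evaluate_add[of \<mu> p "- p" v] by (simp add: add_eq_0_iff)

lemma evaluate_diff: "evaluate \<mu> (p - q) v = evaluate \<mu> p v - evaluate \<mu> q v"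
  using evaluate_add[of \<mu> p "- q" v] by (simp add: evaluate_uminus)

lemma evaluate_sum: "evaluate \<mu> (\<Sum>i\<in>A. f i) v = (\<Sum>i\<in>A. evaluate \<mu> (f i) v)"
  by (induction A rule: infinite_finite_induct) (auto simp: evaluate_add)

lemma foldr_wact_add: "foldr (wact \<mu>) w (u + v) = foldr (wact \<mu>) w u + foldr (wact \<mu>) w v"
  by (induction w) (auto simp: wact_add_right)

lemma foldr_wact_scale: "foldr (wact \<mu>) w (wscale c v) = wscale c (foldr (wact \<mu>) w v)"
  by (induction w) (auto simp: wact_scale_right)

lemma evaluate_add_right: "evaluate \<mu> p (u + v) = evaluate \<mu> p u + evaluate \<mu> p v"
  by (simp add: evaluate_def foldr_wact_add ws.scale_right_distrib sum.distrib)

lemma evaluate_zero_right [simp]: "evaluate \<mu> p 0 = 0"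
  using evaluate_add_right[of \<mu> p 0 0] by simp

lemma evaluate_mult: "evaluate \<mu> (p * q) v = evaluate \<mu> p (evaluate \<mu> q v)"
proof -
  have sum_right: "evaluate \<mu> p (\<Sum>i\<in>A. f i) = (\<Sum>i\<in>A. evaluate \<mu> p (f i))" for p A
    and f :: "(complex^2^2) list \<Rightarrow> weight_space"
    by (induction A rule: infinite_finite_induct) (auto simp: evaluate_add_right)
  let ?m = "\<lambda>p w. Poly_Mapping.single w (coef p w)"
  have "evaluate \<mu> (p * q) v =
      evaluate \<mu> ((\<Sum>w\<in>Poly_Mapping.keys p. ?m p w) * (\<Sum>w\<in>Poly_Mapping.keys q. ?m q w)) v"
    by (simp flip: poly_mapping_expansion)
  also have "\<dots> = (\<Sum>w\<in>Poly_Mapping.keys p. \<Sum>w'\<in>Poly_Mapping.keys q.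
      evaluate \<mu> (?m p w) (evaluate \<mu> (?m q w') v))"
    by (simp add: sum_product evaluate_sum mult_single evaluate_single plus_list_def foldr_wact_scale)
  also have "\<dots> = evaluate \<mu> (\<Sum>w\<in>Poly_Mapping.keys p. ?m p w)
      (evaluate \<mu> (\<Sum>w\<in>Poly_Mapping.keys q. ?m q w) v)"
    by (simp add: evaluate_sum sum_right)
  also have "\<dots> = evaluate \<mu> p (evaluate \<mu> q v)"
    by (simp flip: poly_mapping_expansion)
  finally show ?thesis .
qed

section \<open>The free algebra on the elements of \<open>sl2\<close> as a ring\<close>

lemma free_algebra_sel [simp]:
  "mult free_algebra = (*)" "one free_algebra = 1" "zero free_algebra = 0" "add free_algebra = (+)"
  by (simp_all add: free_algebra_def ring_of_type_def)

lemma free_algebra_carrier: "p \<in> carrier free_algebra \<longleftrightarrow> (\<forall>w\<in>Poly_Mapping.keys p. set w \<subseteq> sl2)"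
  by (simp add: free_algebra_def)

lemma gen_closed [simp]: "a \<in> sl2 \<Longrightarrow> gen a \<in> carrier free_algebra"
  by (simp add: free_algebra_carrier gen_def)

lemma scal_closed [simp]: "scal k \<in> carrier free_algebra"
  by (simp add: free_algebra_carrier scal_def)

lemma free_algebra_closed [simp]:
  "0 \<in> carrier free_algebra" "1 \<in> carrier free_algebra"
  "p \<in> carrier free_algebra \<Longrightarrow> - p \<in> carrier free_algebra"
  "p \<in> carrier free_algebra \<Longrightarrow> q \<in> carrier free_algebra \<Longrightarrow> p + q \<in> carrier free_algebra"
  "p \<in> carrier free_algebra \<Longrightarrow> q \<in> carrier free_algebra \<Longrightarrow> p - q \<in> carrier free_algebra"
  "p \<in> carrier free_algebra \<Longrightarrow> q \<in> carrier free_algebra \<Longrightarrow> p * q \<in> carrier free_algebra"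
proof -
  show "0 \<in> carrier free_algebra" "1 \<in> carrier free_algebra"
    "p \<in> carrier free_algebra \<Longrightarrow> - p \<in> carrier free_algebra"
    by (auto simp: free_algebra_carrier zero_list_def in_keys_iff)
  show "p \<in> carrier free_algebra \<Longrightarrow> q \<in> carrier free_algebra \<Longrightarrow> p + q \<in> carrier free_algebra"
    using keys_add[of p q] by (fastforce simp: free_algebra_carrier)
  show "p - q \<in> carrier free_algebra" if "p \<in> carrier free_algebra" "q \<in> carrier free_algebra"
  proof -
    have "w \<in> Poly_Mapping.keys p \<or> w \<in> Poly_Mapping.keys q" if "w \<in> Poly_Mapping.keys (p - q)" for w
      using that by (auto simp: in_keys_iff lookup_minus)
    then show ?thesis using that unfolding free_algebra_carrier by blast
  qed
  show "p \<in> carrier free_algebra \<Longrightarrow> q \<in> carrier free_algebra \<Longrightarrow> p * q \<in> carrier free_algebra"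
    using keys_mult[of p q] by (fastforce simp: free_algebra_carrier plus_list_def)
qed

lemma sum_closed [simp]:
  "(\<And>i. i \<in> A \<Longrightarrow> f i \<in> carrier free_algebra) \<Longrightarrow> (\<Sum>i\<in>A. f i) \<in> carrier free_algebra"
  by (induction A rule: infinite_finite_induct) auto

lemma power_closed [simp]: "p \<in> carrier free_algebra \<Longrightarrow> p ^ n \<in> carrier free_algebra"
  by (induction n) auto

lemma ring_free_algebra: "ring free_algebra"
proof (intro ringI abelian_groupI monoidI)
  fix p assume "p \<in> carrier free_algebra"
  then show "\<exists>q\<in>carrier free_algebra. q \<oplus>\<^bsub>free_algebra\<^esub> p = \<zero>\<^bsub>free_algebra\<^esub>"
    by (intro bexI[of _ "- p"]) auto
qed (auto simp: algebra_simps)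

interpretation FA: ring free_algebra
  by (rule ring_free_algebra)

lemma free_algebra_a_inv: "p \<in> carrier free_algebra \<Longrightarrow> \<ominus>\<^bsub>free_algebra\<^esub> p = - p"
  by (rule FA.minus_equality) auto

lemma scal_mult_single: "scal k * Poly_Mapping.single w c = Poly_Mapping.single w (k * c)"
  "Poly_Mapping.single w c * scal k = Poly_Mapping.single w (k * c)"
  by (simp_all add: scal_def mult_single plus_list_def mult.commute)

lemma scal_commute: "scal k * p = p * scal k"
proof -
  have "scal k * (\<Sum>w\<in>Poly_Mapping.keys p. Poly_Mapping.single w (coef p w)) =
      (\<Sum>w\<in>Poly_Mapping.keys p. Poly_Mapping.single w (coef p w)) * scal k"
    by (simp add: sum_distrib_left sum_distrib_right scal_mult_single)
  then show ?thesis by (simp flip: poly_mapping_expansion)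
qed

lemma scal_add: "scal (k + l) = scal k + scal l"
  by (simp add: scal_def single_add)

lemma scal_mult: "scal (k * l) = scal k * scal l"
  by (simp add: scal_def mult_single plus_list_def)

subsection \<open>Homogeneous elements\<close>

lemma free_component_closed: "free_component g \<subseteq> carrier free_algebra"
proof
  fix p assume p: "p \<in> free_component g"
  have "set w \<subseteq> sl2" if "list_all2 (\<lambda>a d. a \<in> pauli d) w gs" for w gs
    using that by (induction rule: list_all2_induct) (auto intro: sl2_pauli)
  then show "p \<in> carrier free_algebra"
    using p by (fastforce simp: free_component_def free_algebra_carrier)
qed

lemma one_in_free_component: "1 \<in> free_component 0"
  by (auto simp: free_component_def zero_list_def)

lemma free_component_zero: "0 \<in> free_component g"
  by (simp add: free_component_def)

lemma free_component_add:
  "p \<in> free_component g \<Longrightarrow> q \<in> free_component g \<Longrightarrow> p + q \<in> free_component g"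
  using keys_add[of p q] unfolding free_component_def by blast

lemma free_component_scal:
  assumes "p \<in> free_component g" shows "scal k * p \<in> free_component g"
proof -
  have "Poly_Mapping.keys (scal k * p) \<subseteq> Poly_Mapping.keys p"
    using keys_mult[of "scal k" p] by (auto simp: scal_def plus_list_def split: if_splits)
  then show ?thesis using assms unfolding free_component_def by blast
qed

lemma free_component_gen:
  assumes "a \<in> pauli d" "p \<in> free_component g" shows "gen a * p \<in> free_component (d + g)"
  unfolding free_component_def
proof (intro CollectI ballI)
  fix w assume "w \<in> Poly_Mapping.keys (gen a * p)"
  then obtain w' where w': "w = a # w'" "w' \<in> Poly_Mapping.keys p"
    using keys_mult[of "gen a" p] by (auto simp: gen_def plus_list_def)
  then obtain gs where "list_all2 (\<lambda>a d. a \<in> pauli d) w' gs" "sum_list gs = g"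
    using assms(2) by (auto simp: free_component_def)
  then show "\<exists>gs. list_all2 (\<lambda>a d. a \<in> pauli d) w gs \<and> sum_list gs = d + g"
    using assms(1) w'(1) by (intro exI[of _ "d # gs"]) auto
qed

text \<open>\<open>basis_vec 0\<close> is even and symmetric, hence of degree \<open>0\<close>, and
  each homogeneous letter of a word adds its own degree.\<close>

lemma evaluate_free_component:
  assumes "p \<in> free_component g" shows "evaluate \<mu> p (basis_vec 0) \<in> weight_component g"
  unfolding evaluate_def
proof (intro ws.subspace_sum[OF subspace_weight_component] ws.subspace_scale[OF subspace_weight_component])
  fix w assume "w \<in> Poly_Mapping.keys p"
  then obtain gs where gs: "list_all2 (\<lambda>a d. a \<in> pauli d) w gs" "sum_list gs = g"
    using assms by (auto simp: free_component_def)
  have "foldr (wact \<mu>) w (basis_vec 0) \<in> weight_component (sum_list gs)"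
    using gs(1) by (induction rule: list_all2_induct) (simp_all add: basis_vec_0_component wact_component del: add_bit_eq_xor)
  then show "foldr (wact \<mu>) w (basis_vec 0) \<in> weight_component g" by (simp only: gs(2))
qed

lemma subspace_evaluate_free_component:
  "ws.subspace ((\<lambda>p. evaluate \<mu> p v) ` free_component g)"
proof (rule ws.subspaceI)
  show "0 \<in> (\<lambda>p. evaluate \<mu> p v) ` free_component g"
    using free_component_zero[of g] by (auto intro!: image_eqI[of _ _ 0])
next
  fix u w assume "u \<in> (\<lambda>p. evaluate \<mu> p v) ` free_component g" "w \<in> (\<lambda>p. evaluate \<mu> p v) ` free_component g"
  then obtain p q where "p \<in> free_component g" "q \<in> free_component g"
    "u = evaluate \<mu> p v" "w = evaluate \<mu> q v" by blast
  then show "u + w \<in> (\<lambda>p. evaluate \<mu> p v) ` free_component g"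
    by (intro image_eqI[of _ _ "p + q"]) (auto simp: evaluate_add free_component_add)
next
  fix c w assume "w \<in> (\<lambda>p. evaluate \<mu> p v) ` free_component g"
  then obtain p where "p \<in> free_component g" "w = evaluate \<mu> p v" by blast
  then show "wscale c w \<in> (\<lambda>p. evaluate \<mu> p v) ` free_component g"
    by (intro image_eqI[of _ _ "scal c * p"]) (auto simp: evaluate_mult free_component_scal)
qed

lemma wact_evaluate_free_component:
  assumes "a \<in> pauli d" "u \<in> (\<lambda>p. evaluate \<mu> p v) ` free_component g"
  shows "wact \<mu> a u \<in> (\<lambda>p. evaluate \<mu> p v) ` free_component (d + g)"
proof -
  obtain p where p: "p \<in> free_component g" "u = evaluate \<mu> p v" using assms(2) by blast
  show ?thesis
    by (rule image_eqI[of _ _ "gen a * p"])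
      (simp add: p evaluate_mult, rule free_component_gen[OF assms(1) p(1)])
qed

subsection \<open>Annihilators\<close>

text \<open>Being a two-sided ideal, it contains the ideal generated by any relations that act as
  zero, so the elements of that ideal need no explicit description.\<close>

definition annihilator :: "complex \<Rightarrow> sl2_free set" where
  "annihilator \<mu> = {p \<in> carrier free_algebra. \<forall>v. evaluate \<mu> p v = 0}"

lemma ideal_annihilator: "ideal (annihilator \<mu>) free_algebra"
proof (rule idealI[OF ring_free_algebra])
  show "subgroup (annihilator \<mu>) (add_monoid free_algebra)"
  proof (rule subgroup.intro)
    fix p assume "p \<in> annihilator \<mu>"
    then have "\<ominus>\<^bsub>free_algebra\<^esub> p \<in> annihilator \<mu>"
      by (auto simp: annihilator_def free_algebra_a_inv evaluate_uminus)
    then show "inv\<^bsub>add_monoid free_algebra\<^esub> p \<in> annihilator \<mu>" by (simp add: a_inv_def)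
  qed (auto simp: annihilator_def evaluate_add)
qed (auto simp: annihilator_def evaluate_mult)

lemma uea_relations_closed: "uea_relations \<subseteq> carrier free_algebra"
  by (auto simp: uea_relations_def)

lemma uea_relations_annihilator: "uea_relations \<subseteq> annihilator \<mu>"
proof
  fix p assume p: "p \<in> uea_relations"
  then have "p \<in> carrier free_algebra" using uea_relations_closed by blast
  then show "p \<in> annihilator \<mu>"
    using p by (auto simp: annihilator_def uea_relations_def evaluate_add evaluate_diff evaluate_mult
        wact_add_left wact_scale_left wact_bracket)
qed

lemma uea_ideal_annihilator: "uea_ideal \<subseteq> annihilator \<mu>"
  unfolding uea_ideal_def
  by (rule FA.genideal_minimal[OF ideal_annihilator uea_relations_annihilator])

section \<open>The module as a quotient of the free algebra\<close>

lemma ideal_uea_ideal: "ideal uea_ideal free_algebra"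
  unfolding uea_ideal_def by (rule FA.genideal_ideal[OF uea_relations_closed])

lemma uea_class_hom: "ring_hom_ring free_algebra uea uea_class"
  using ideal.rcos_ring_hom_ring[OF ideal_uea_ideal] unfolding uea_def uea_class_def[abs_def] .

interpretation uc: ring_hom_ring free_algebra uea uea_class
  by (rule uea_class_hom)

lemma (in abelian_group) a_minus_eq_zero_iff:
  assumes "a \<in> carrier G" "b \<in> carrier G"
  shows "a \<ominus> b = \<zero> \<longleftrightarrow> a = b"
  using minus_equality[of a "\<ominus> b"] assms by (auto simp: a_minus_def r_neg)

lemma a_rcosets_image: "a_rcosets\<^bsub>G\<^esub> H = (\<lambda>x. H +>\<^bsub>G\<^esub> x) ` carrier G"
  by (auto simp: A_RCOSETS_def RCOSETS_def a_r_coset_def)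

lemma uea_carrier: "carrier uea = uea_class ` carrier free_algebra"
  by (simp add: uea_def FactRing_def a_rcosets_image uea_class_def)

lemma uea_zero: "\<zero>\<^bsub>uea\<^esub> = uea_ideal"
  by (simp add: uea_def FactRing_def)

lemma uea_class_eq_zero:
  assumes "p \<in> carrier free_algebra"
  shows "uea_class p = \<zero>\<^bsub>uea\<^esub> \<longleftrightarrow> p \<in> uea_ideal"
proof -
  interpret I: ideal uea_ideal free_algebra by (rule ideal_uea_ideal)
  show ?thesis
    using I.a_rcos_const[of p] I.a_rcos_self[of p] assms unfolding uea_zero uea_class_def by auto
qed

lemma uea_class_diff:
  "p \<in> carrier free_algebra \<Longrightarrow> q \<in> carrier free_algebra \<Longrightarrow>
    uea_class p \<ominus>\<^bsub>uea\<^esub> uea_class q = uea_class (p - q)"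
  using uc.hom_add[of p "- q"] uc.hom_a_inv[of q] by (simp add: a_minus_def free_algebra_a_inv)

section \<open>The Casimir relation and the central quotient\<close>

definition casimir_relation :: "complex \<Rightarrow> sl2_free" where
  "casimir_relation lam =
    (gen sl2_h + 1)\<^sup>2 + scal 4 * (gen sl2_y * gen sl2_x) - scal ((lam + 1)\<^sup>2)"

lemma casimir_relation_closed [simp]: "casimir_relation lam \<in> carrier free_algebra"
  by (simp add: casimir_relation_def)

lemma uea_class_casimir_relation:
  "uea_class (casimir_relation lam) = casimir \<ominus>\<^bsub>uea\<^esub> uea_const ((lam + 1)\<^sup>2)"
proof -
  have c: "casimir = uea_class ((gen sl2_h + 1)\<^sup>2 + scal 4 * (gen sl2_y * gen sl2_x))"
    using uc.hom_mult uc.hom_add uc.hom_one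
    by (simp add: casimir_def uea_incl_def uea_const_def numeral_2_eq_2 power2_eq_square)
  show ?thesis
    unfolding casimir_relation_def uea_const_def c by (rule uea_class_diff[symmetric]) simp_all
qed

text \<open>Rewriting \<open>4 y x\<close> as \<open>(B - C) (B + C)\<close> leaves only operators
  with explicit coefficients. For \<open>\<mu> = lam / 2\<close> the ladder coefficients multiply to
  \<open>(lam - 2 n) (lam + 2 n + 2)\<close>, which \<open>(2 n + 1)^2\<close> completes to
  \<open>(lam + 1)^2\<close> at every weight.\<close>

lemma casimir_relation_annihilator: "casimir_relation lam \<in> annihilator (lam / 2)"
proof -
  define \<mu> where "\<mu> = lam / 2"
  have lam: "lam = 2 * \<mu>" by (simp add: \<mu>_def)
  let ?B = "wact \<mu> sl2_B" and ?C = "wact \<mu> sl2_C" and ?h = "wact \<mu> sl2_h"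
  have x: "wact \<mu> sl2_x v = wscale (1 / 2) (?B v + ?C v)"
    and y: "wact \<mu> sl2_y v = wscale (1 / 2) (?B v - ?C v)" for v
    unfolding wact_sl2_B wact_sl2_C
    by (simp_all add: wact_def sl2_x_def sl2_y_def vector_2 ws.scale_right_distrib
        ws.scale_right_diff_distrib)
  have "evaluate \<mu> (casimir_relation lam) v = 0" for v
  proof -
    have yx: "wscale 4 (wact \<mu> sl2_y (wact \<mu> sl2_x v)) = ?B (?B v + ?C v) - ?C (?B v + ?C v)"
      unfolding x y by (simp add: wact_scale_right ws.scale_right_diff_distrib)
    have "evaluate \<mu> (casimir_relation lam) v =
        ?h (?h v + v) + (?h v + v) + (?B (?B v + ?C v) - ?C (?B v + ?C v)) - wscale ((2 * \<mu> + 1)\<^sup>2) v"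
      by (simp add: casimir_relation_def power2_eq_square[of "gen sl2_h + 1"] evaluate_diff
          evaluate_add evaluate_mult yx lam)
    also have "\<dots> = 0"
    proof (rule poly_mapping_eqI)
      fix n :: int
      have n: "n - 1 - 1 = n - 2" "n + 1 + 1 = n + 2" "n + 1 - 1 = n" "n - 1 + 1 = n" by simp_all
      show "coef (?h (?h v + v) + (?h v + v) + (?B (?B v + ?C v) - ?C (?B v + ?C v)) -
          wscale ((2 * \<mu> + 1)\<^sup>2) v) n = coef 0 n"
        unfolding lookup_add lookup_minus coef_wact_h coef_wact_B wact_sl2_C
        unfolding lookup_add lookup_minus coef_wact_h coef_wact_B lookup_ops n
        by (simp add: algebra_simps power2_eq_square ii_mult)
    qed
    finally show ?thesis .
  qed
  then show ?thesis by (simp add: annihilator_def \<mu>_def)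
qed

lemma ideal_I_ideal: "ideal (I_ideal lam) uea"
  unfolding I_ideal_def uea_class_casimir_relation[symmetric]
  by (intro uc.S.genideal_ideal) auto

text \<open>The image of the annihilator is an ideal of the quotient that contains the generator,
  and \<open>I_ideal\<close> is the least such ideal.\<close>

lemma I_ideal_annihilator: "I_ideal lam \<subseteq> uea_class ` annihilator (lam / 2)"
  unfolding I_ideal_def uea_class_casimir_relation[symmetric]
proof (rule uc.S.genideal_minimal)
  show "ideal (uea_class ` annihilator (lam / 2)) uea"
    using FA.ring_ideal_imp_quot_ideal[OF ideal_uea_ideal ideal_annihilator]
    unfolding uea_def uea_class_def[abs_def] .
qed (use casimir_relation_annihilator in auto)

definition U_I_of :: "complex \<Rightarrow> sl2_free \<Rightarrow> sl2_free set set" where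
  "U_I_of lam p = U_I_class lam (uea_class p)"

lemma U_I_class_hom: "ring_hom_ring uea (U_I lam) (U_I_class lam)"
  using ideal.rcos_ring_hom_ring[OF ideal_I_ideal] unfolding U_I_def U_I_class_def[abs_def] .

lemma U_I_of_hom: "ring_hom_ring free_algebra (U_I lam) (U_I_of lam)"
proof -
  interpret h: ring_hom_ring uea "U_I lam" "U_I_class lam" by (rule U_I_class_hom)
  have "U_I_class lam \<circ> uea_class \<in> ring_hom free_algebra (U_I lam)"
    by (rule ring_hom_trans[OF uc.homh h.homh])
  then show ?thesis
    by (intro ring_hom_ringI2 ring_free_algebra h.S.ring_axioms) (simp add: U_I_of_def[abs_def] comp_def)
qed

lemma U_I_carrier: "carrier (U_I lam) = U_I_of lam ` carrier free_algebra"
  by (simp add: U_I_def FactRing_def a_rcosets_image U_I_of_def U_I_class_def uea_carrier image_image)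

lemma U_I_of_eq_zero:
  assumes "p \<in> carrier free_algebra"
  shows "U_I_of lam p = \<zero>\<^bsub>U_I lam\<^esub> \<longleftrightarrow> uea_class p \<in> I_ideal lam"
proof -
  interpret I: ideal "I_ideal lam" uea by (rule ideal_I_ideal)
  have "\<zero>\<^bsub>U_I lam\<^esub> = I_ideal lam" by (simp add: U_I_def FactRing_def)
  then show ?thesis
    using I.a_rcos_const[of "uea_class p"] I.a_rcos_self[of "uea_class p"] assms
    unfolding U_I_of_def U_I_class_def by auto
qed

text \<open>A class in \<open>I_ideal\<close> has an annihilating representative; any other
  representative differs from it by an element of \<open>uea_ideal\<close>, which annihilates
  too.\<close>

lemma U_I_of_eq_zero_annihilator:
  assumes p: "p \<in> carrier free_algebra" and "U_I_of lam p = \<zero>\<^bsub>U_I lam\<^esub>"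
  shows "p \<in> annihilator (lam / 2)"
proof -
  have "uea_class p \<in> uea_class ` annihilator (lam / 2)"
    using assms I_ideal_annihilator by (auto simp: U_I_of_eq_zero)
  then obtain q where q: "q \<in> annihilator (lam / 2)" "uea_class p = uea_class q" by blast
  then have qc: "q \<in> carrier free_algebra" by (simp add: annihilator_def)
  have "uea_class (p - q) = \<zero>\<^bsub>uea\<^esub>"
    using p qc q(2) by (simp add: a_minus_def uc.S.r_neg flip: uea_class_diff)
  then have "p - q \<in> annihilator (lam / 2)"
    using uea_class_eq_zero[of "p - q"] p qc uea_ideal_annihilator by auto
  then show ?thesis using q p by (auto simp: annihilator_def evaluate_diff)
qed

section \<open>Cosets of the left ideal generated by \<open>C\<close>\<close>

definition MC_of :: "complex \<Rightarrow> sl2_free \<Rightarrow> sl2_free set set set" where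
  "MC_of lam p = MC_class lam (U_I_of lam p)"

lemma MC_left_ideal_eq:
  "MC_left_ideal lam = (\<lambda>f. U_I_of lam (f * gen sl2_C)) ` carrier free_algebra"
proof -
  interpret h: ring_hom_ring free_algebra "U_I lam" "U_I_of lam" by (rule U_I_of_hom)
  have "U_I_of lam (f * gen sl2_C) = U_I_of lam f \<otimes>\<^bsub>U_I lam\<^esub> U_I_of lam (gen sl2_C)"
    if "f \<in> carrier free_algebra" for f
    using that h.hom_mult[of f "gen sl2_C"] by simp
  then show ?thesis
    by (auto simp: MC_left_ideal_def cgenideal_def U_I_carrier uea_incl_def simp flip: U_I_of_def)
qed

lemma U_I_of_diff:
  assumes "p \<in> carrier free_algebra" "q \<in> carrier free_algebra"
  shows "U_I_of lam p \<ominus>\<^bsub>U_I lam\<^esub> U_I_of lam q = U_I_of lam (p - q)"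
proof -
  interpret h: ring_hom_ring free_algebra "U_I lam" "U_I_of lam" by (rule U_I_of_hom)
  show ?thesis
    using h.hom_add[of p "- q"] h.hom_a_inv[of q] assms by (simp add: a_minus_def free_algebra_a_inv)
qed

lemma abelian_subgroup_MC_left_ideal: "abelian_subgroup (MC_left_ideal lam) (U_I lam)"
proof (rule abelian_subgroupI3)
  interpret h: ring_hom_ring free_algebra "U_I lam" "U_I_of lam" by (rule U_I_of_hom)
  show "abelian_group (U_I lam)" by (rule h.S.is_abelian_group)
  show "additive_subgroup (MC_left_ideal lam) (U_I lam)"
  proof (rule additive_subgroupI, rule subgroup.intro)
    show "MC_left_ideal lam \<subseteq> carrier (add_monoid (U_I lam))"
      by (auto simp: MC_left_ideal_eq)
  next
    fix x y assume "x \<in> MC_left_ideal lam" "y \<in> MC_left_ideal lam"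
    then obtain f g where fg: "f \<in> carrier free_algebra" "g \<in> carrier free_algebra"
      "x = U_I_of lam (f * gen sl2_C)" "y = U_I_of lam (g * gen sl2_C)"
      by (auto simp: MC_left_ideal_eq)
    then have "x \<oplus>\<^bsub>U_I lam\<^esub> y = U_I_of lam ((f + g) * gen sl2_C)"
      using h.hom_add[of "f * gen sl2_C" "g * gen sl2_C"] by (simp add: distrib_right)
    then show "x \<otimes>\<^bsub>add_monoid (U_I lam)\<^esub> y \<in> MC_left_ideal lam"
      using fg by (auto simp: MC_left_ideal_eq)
  next
    show "\<one>\<^bsub>add_monoid (U_I lam)\<^esub> \<in> MC_left_ideal lam"
      unfolding MC_left_ideal_eq using h.hom_zero by (intro image_eqI[of _ _ 0]) auto
  next
    fix x assume "x \<in> MC_left_ideal lam"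
    then obtain f where f: "f \<in> carrier free_algebra" "x = U_I_of lam (f * gen sl2_C)"
      by (auto simp: MC_left_ideal_eq)
    have "\<ominus>\<^bsub>U_I lam\<^esub> x = U_I_of lam (- f * gen sl2_C)"
      using h.hom_a_inv[of "f * gen sl2_C"] f by (simp add: free_algebra_a_inv)
    then have "\<ominus>\<^bsub>U_I lam\<^esub> x \<in> MC_left_ideal lam"
      unfolding MC_left_ideal_eq using f(1) by (intro image_eqI[of _ _ "- f"]) auto
    then show "inv\<^bsub>add_monoid (U_I lam)\<^esub> x \<in> MC_left_ideal lam" by (simp add: a_inv_def)
  qed
qed

text \<open>Reduces equality of threefold nested cosets to one equation between classes of free
  algebra elements; \<open>f\<close> is the witness for membership in the left ideal.\<close>

lemma MC_of_eq_iff: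
  assumes p: "p \<in> carrier free_algebra" and q: "q \<in> carrier free_algebra"
  shows "MC_of lam p = MC_of lam q \<longleftrightarrow>
    (\<exists>f\<in>carrier free_algebra. U_I_of lam (p - q - f * gen sl2_C) = \<zero>\<^bsub>U_I lam\<^esub>)"
proof -
  interpret h: ring_hom_ring free_algebra "U_I lam" "U_I_of lam" by (rule U_I_of_hom)
  interpret L: abelian_subgroup "MC_left_ideal lam" "U_I lam" by (rule abelian_subgroup_MC_left_ideal)
  have "MC_of lam p = MC_of lam q \<longleftrightarrow> U_I_of lam p \<in> MC_class lam (U_I_of lam q)"
    unfolding MC_of_def MC_class_def
  proof
    assume "MC_left_ideal lam +>\<^bsub>U_I lam\<^esub> U_I_of lam p = MC_left_ideal lam +>\<^bsub>U_I lam\<^esub> U_I_of lam q"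
    then show "U_I_of lam p \<in> MC_left_ideal lam +>\<^bsub>U_I lam\<^esub> U_I_of lam q"
      by (rule L.a_repr_independenceD[rotated, OF sym]) (use p in simp)
  next
    assume "U_I_of lam p \<in> MC_left_ideal lam +>\<^bsub>U_I lam\<^esub> U_I_of lam q"
    from L.a_repr_independence'[OF this]
    show "MC_left_ideal lam +>\<^bsub>U_I lam\<^esub> U_I_of lam p = MC_left_ideal lam +>\<^bsub>U_I lam\<^esub> U_I_of lam q"
      by (rule sym) (use q in simp)
  qed
  also have "\<dots> \<longleftrightarrow> U_I_of lam (p - q) \<in> MC_left_ideal lam"
    unfolding MC_class_def U_I_of_diff[OF p q, symmetric]
    by (rule L.a_rcos_module_minus[OF h.S.ring_axioms]) (use p q in simp_all)
  also have "\<dots> \<longleftrightarrow> (\<exists>f\<in>carrier free_algebra. U_I_of lam (p - q - f * gen sl2_C) = \<zero>\<^bsub>U_I lam\<^esub>)"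
    unfolding MC_left_ideal_eq image_iff
  proof (intro bex_cong refl)
    fix f assume f: "f \<in> carrier free_algebra"
    show "U_I_of lam (p - q) = U_I_of lam (f * gen sl2_C) \<longleftrightarrow>
        U_I_of lam (p - q - f * gen sl2_C) = \<zero>\<^bsub>U_I lam\<^esub>"
      using f p q by (subst U_I_of_diff[symmetric]) (simp_all add: h.S.a_minus_eq_zero_iff)
  qed
  finally show ?thesis .
qed

lemma MC_of_eqI:
  assumes "p \<in> carrier free_algebra" "q \<in> carrier free_algebra" "f \<in> carrier free_algebra"
    and "U_I_of lam (p - q - f * gen sl2_C) = \<zero>\<^bsub>U_I lam\<^esub>"
  shows "MC_of lam p = MC_of lam q"
  using MC_of_eq_iff[THEN iffD2, OF assms(1,2)] assms(3,4) by blast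

text \<open>Evaluation at \<open>basis_vec 0\<close> is well defined on cosets: the relations act as
  zero, and left multiples of \<open>C\<close> kill the vector of weight zero.\<close>

lemma MC_of_eqD:
  assumes "MC_of lam p = MC_of lam q" "p \<in> carrier free_algebra" "q \<in> carrier free_algebra"
  shows "evaluate (lam / 2) p (basis_vec 0) = evaluate (lam / 2) q (basis_vec 0)"
proof -
  obtain f where f: "f \<in> carrier free_algebra" "U_I_of lam (p - q - f * gen sl2_C) = \<zero>\<^bsub>U_I lam\<^esub>"
    using MC_of_eq_iff[THEN iffD1, OF assms(2,3,1)] by blast
  then have "p - q - f * gen sl2_C \<in> annihilator (lam / 2)"
    using assms by (intro U_I_of_eq_zero_annihilator) auto
  then have "evaluate (lam / 2) (p - q - f * gen sl2_C) (basis_vec 0) = 0"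
    by (simp add: annihilator_def)
  then show ?thesis
    by (simp add: evaluate_diff evaluate_mult wact_sl2_C weight_basis_vec)
qed

lemma U_I_of_relation:
  assumes "r \<in> uea_relations \<or> r = casimir_relation lam"
    and p: "p \<in> carrier free_algebra"
  shows "U_I_of lam (r * p) = \<zero>\<^bsub>U_I lam\<^esub>"
proof -
  interpret h: ring_hom_ring free_algebra "U_I lam" "U_I_of lam" by (rule U_I_of_hom)
  interpret I: ideal "I_ideal lam" uea by (rule ideal_I_ideal)
  have r: "r \<in> carrier free_algebra" using assms(1) uea_relations_closed by auto
  have "uea_class r \<in> I_ideal lam"
    using assms(1)
  proof
    assume "r \<in> uea_relations"
    then have "r \<in> uea_ideal"
      unfolding uea_ideal_def using FA.genideal_self[OF uea_relations_closed] by blast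
    then show ?thesis using uea_class_eq_zero[OF r] I.zero_closed by simp
  next
    assume "r = casimir_relation lam"
    then show ?thesis
      using uc.S.genideal_self'[of "uea_class (casimir_relation lam)"]
      by (simp add: I_ideal_def flip: uea_class_casimir_relation)
  qed
  then have "U_I_of lam r = \<zero>\<^bsub>U_I lam\<^esub>" using r by (simp add: U_I_of_eq_zero)
  then show ?thesis using h.hom_mult[of r p] r p by simp
qed

text \<open>The arbitrary right factor \<open>p\<close> reflects that these relations generate
  two-sided ideals, in contrast to \<open>gen sl2_C\<close>.\<close>

lemma MC_of_relation:
  assumes "r \<in> uea_relations \<or> r = casimir_relation lam" "p \<in> carrier free_algebra"
  shows "MC_of lam (r * p) = MC_of lam 0"
proof -
  have "r \<in> carrier free_algebra" using assms(1) uea_relations_closed by auto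
  then show ?thesis
    by (intro MC_of_eqI[where f = 0]) (simp_all add: U_I_of_relation[OF assms] assms(2))
qed

lemma MC_of_C: "MC_of lam (gen sl2_C) = MC_of lam 0"
proof -
  interpret h: ring_hom_ring free_algebra "U_I lam" "U_I_of lam" by (rule U_I_of_hom)
  show ?thesis
    using h.hom_zero by (intro MC_of_eqI[where f = 1]) simp_all
qed

lemma MC_carrier: "carrier (MC lam) = MC_of lam ` carrier free_algebra"
  by (simp add: MC_def a_rcosets_image U_I_carrier MC_of_def MC_class_def image_image)

lemma MC_zero: "\<zero>\<^bsub>MC lam\<^esub> = MC_of lam 0"
proof -
  interpret h: ring_hom_ring free_algebra "U_I lam" "U_I_of lam" by (rule U_I_of_hom)
  interpret L: abelian_subgroup "MC_left_ideal lam" "U_I lam" by (rule abelian_subgroup_MC_left_ideal)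
  show ?thesis
    using L.a_rcos_const[OF L.zero_closed] h.hom_zero by (simp add: MC_def MC_of_def MC_class_def)
qed

lemma MC_add:
  assumes "p \<in> carrier free_algebra" "q \<in> carrier free_algebra"
  shows "MC_of lam p \<oplus>\<^bsub>MC lam\<^esub> MC_of lam q = MC_of lam (p + q)"
proof -
  interpret h: ring_hom_ring free_algebra "U_I lam" "U_I_of lam" by (rule U_I_of_hom)
  interpret L: abelian_subgroup "MC_left_ideal lam" "U_I lam" by (rule abelian_subgroup_MC_left_ideal)
  show ?thesis
    using L.a_rcos_sum[of "U_I_of lam p" "U_I_of lam q"] h.hom_add[of p q] assms
    by (simp add: MC_def MC_of_def MC_class_def)
qed

text \<open>Left multiplication by \<open>f\<close> turns a witness \<open>g\<close> for the
  equality of cosets into the witness \<open>f * g\<close>.\<close>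

lemma MC_of_mult_cong:
  assumes "MC_of lam p = MC_of lam q"
    and closed: "p \<in> carrier free_algebra" "q \<in> carrier free_algebra" "f \<in> carrier free_algebra"
  shows "MC_of lam (f * p) = MC_of lam (f * q)"
proof -
  interpret h: ring_hom_ring free_algebra "U_I lam" "U_I_of lam" by (rule U_I_of_hom)
  obtain g where g: "g \<in> carrier free_algebra" "U_I_of lam (p - q - g * gen sl2_C) = \<zero>\<^bsub>U_I lam\<^esub>"
    using MC_of_eq_iff[THEN iffD1, OF closed(1,2) assms(1)] by blast
  have "U_I_of lam (f * (p - q - g * gen sl2_C)) = \<zero>\<^bsub>U_I lam\<^esub>"
    using g closed h.hom_mult[of f "p - q - g * gen sl2_C"] by simp
  then show ?thesis
    using g(1) closed by (intro MC_of_eqI[where f = "f * g"]) (simp_all add: algebra_simps)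
qed

lemma MC_mult_of:
  assumes p: "p \<in> carrier free_algebra" and f: "f \<in> carrier free_algebra"
  shows "MC_mult lam (U_I_of lam f) (MC_of lam p) = MC_of lam (f * p)"
proof -
  interpret h: ring_hom_ring free_algebra "U_I lam" "U_I_of lam" by (rule U_I_of_hom)
  interpret L: abelian_subgroup "MC_left_ideal lam" "U_I lam" by (rule abelian_subgroup_MC_left_ideal)
  have "MC_class lam (U_I_of lam f \<otimes>\<^bsub>U_I lam\<^esub> v) = MC_of lam (f * p)" if v: "v \<in> MC_of lam p" for v
  proof -
    have "v \<in> carrier (U_I lam)"
      using L.a_elemrcos_carrier[of "U_I_of lam p" v] v p by (simp add: MC_of_def MC_class_def)
    then obtain q where q: "q \<in> carrier free_algebra" "v = U_I_of lam q" by (auto simp: U_I_carrier)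
    have "MC_of lam p = MC_of lam q"
      unfolding MC_of_def MC_class_def
      by (rule L.a_repr_independence') (use v p q(2) in \<open>simp_all add: MC_of_def MC_class_def\<close>)
    then have *: "MC_of lam (f * p) = MC_of lam (f * q)" using p q(1) f by (rule MC_of_mult_cong)
    have "U_I_of lam (f * q) = U_I_of lam f \<otimes>\<^bsub>U_I lam\<^esub> v"
      using q f h.hom_mult[of f q] by simp
    then show ?thesis unfolding * by (simp add: MC_of_def)
  qed
  \<comment> \<open>All members of the union coincide; as the coset is nonempty, the union is this
    common value.\<close>
  moreover have "U_I_of lam p \<in> MC_of lam p"
    using L.a_rcos_self[of "U_I_of lam p"] p by (simp add: MC_of_def MC_class_def)
  ultimately show ?thesis unfolding MC_mult_def by blast
qed

lemma MC_smult:
  "p \<in> carrier free_algebra \<Longrightarrow> c \<odot>\<^bsub>MC lam\<^esub> MC_of lam p = MC_of lam (scal c * p)"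
  using MC_mult_of[of p "scal c" lam] by (simp add: MC_def U_I_of_def uea_const_def)

lemma MC_act_of:
  "a \<in> sl2 \<Longrightarrow> p \<in> carrier free_algebra \<Longrightarrow> MC_act lam a (MC_of lam p) = MC_of lam (gen a * p)"
  using MC_mult_of[of p "gen a" lam] by (simp add: MC_act_def U_I_of_def uea_incl_def)

section \<open>The section of the evaluation at the vector of weight zero\<close>

text \<open>The preimage in the free algebra of the zero coset. It is a left ideal, so congruences
  modulo it may be multiplied from the left.\<close>

definition null :: "complex \<Rightarrow> sl2_free set" where
  "null lam = {p \<in> carrier free_algebra. MC_of lam p = MC_of lam 0}"

lemma null_closed: "p \<in> null lam \<Longrightarrow> p \<in> carrier free_algebra"
  by (simp add: null_def)

lemma null_0 [simp]: "0 \<in> null lam"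
  by (simp add: null_def)

lemma null_add:
  assumes "p \<in> null lam" "q \<in> null lam" shows "p + q \<in> null lam"
proof -
  have "MC_of lam (p + q) = MC_of lam p \<oplus>\<^bsub>MC lam\<^esub> MC_of lam q"
    using assms by (simp add: null_closed MC_add)
  also have "\<dots> = MC_of lam 0 \<oplus>\<^bsub>MC lam\<^esub> MC_of lam 0" using assms by (simp add: null_def)
  also have "\<dots> = MC_of lam 0" by (simp add: MC_add)
  finally show ?thesis using assms by (simp add: null_def)
qed

lemma null_mult:
  assumes "p \<in> null lam" "f \<in> carrier free_algebra" shows "f * p \<in> null lam"
  using MC_of_mult_cong[of lam p 0 f] assms by (simp add: null_def)

lemma null_uminus: "p \<in> null lam \<Longrightarrow> - p \<in> null lam"
  using null_mult[of p lam "- 1"] by simp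

lemma null_diff: "p \<in> null lam \<Longrightarrow> q \<in> null lam \<Longrightarrow> p - q \<in> null lam"
  using null_add[of p lam "- q"] by (simp add: null_uminus)

lemma null_sum: "(\<And>i. i \<in> A \<Longrightarrow> f i \<in> null lam) \<Longrightarrow> (\<Sum>i\<in>A. f i) \<in> null lam"
  by (induction A rule: infinite_finite_induct) (auto intro: null_add)

lemma MC_of_eq_null:
  assumes "p - q \<in> null lam" "q \<in> carrier free_algebra"
  shows "MC_of lam p = MC_of lam q"
proof -
  have "MC_of lam p = MC_of lam (p - q) \<oplus>\<^bsub>MC lam\<^esub> MC_of lam q"
    using MC_add[OF null_closed[OF assms(1)] assms(2)] by simp
  also have "\<dots> = MC_of lam 0 \<oplus>\<^bsub>MC lam\<^esub> MC_of lam q" using assms by (simp add: null_def)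
  also have "\<dots> = MC_of lam q" using assms by (simp add: MC_add)
  finally show ?thesis .
qed

text \<open>The annihilator of the coset module in the free algebra, which is the largest two-sided
  ideal inside \<open>null\<close>. Congruences modulo it survive multiplication from both
  sides.\<close>

definition null_ideal :: "complex \<Rightarrow> sl2_free set" where
  "null_ideal lam = {t \<in> carrier free_algebra. \<forall>r\<in>carrier free_algebra. t * r \<in> null lam}"

lemma null_idealD: "t \<in> null_ideal lam \<Longrightarrow> r \<in> carrier free_algebra \<Longrightarrow> t * r \<in> null lam"
  by (simp add: null_ideal_def)

lemma null_ideal_add: "s \<in> null_ideal lam \<Longrightarrow> t \<in> null_ideal lam \<Longrightarrow> s + t \<in> null_ideal lam"
  by (simp add: null_ideal_def distrib_right null_add)

lemma null_ideal_diff: "s \<in> null_ideal lam \<Longrightarrow> t \<in> null_ideal lam \<Longrightarrow> s - t \<in> null_ideal lam"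
  by (simp add: null_ideal_def left_diff_distrib null_diff)

lemma null_ideal_uminus: "t \<in> null_ideal lam \<Longrightarrow> - t \<in> null_ideal lam"
  by (simp add: null_ideal_def null_uminus)

lemma null_ideal_mult_left: "t \<in> null_ideal lam \<Longrightarrow> f \<in> carrier free_algebra \<Longrightarrow> f * t \<in> null_ideal lam"
  by (simp add: null_ideal_def mult.assoc null_mult)

lemma null_ideal_mult_right: "t \<in> null_ideal lam \<Longrightarrow> f \<in> carrier free_algebra \<Longrightarrow> t * f \<in> null_ideal lam"
  by (simp add: null_ideal_def mult.assoc)

lemma null_ideal_relation: "r \<in> uea_relations \<Longrightarrow> r \<in> null_ideal lam"
  using uea_relations_closed MC_of_relation[of r lam] by (auto simp: null_ideal_def null_def)

lemma null_ideal_casimir: "casimir_relation lam \<in> null_ideal lam"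
  using MC_of_relation[of "casimir_relation lam" lam] by (simp add: null_ideal_def null_def)

section \<open>Relations among \<open>h\<close>, \<open>B\<close> and \<open>C\<close> modulo the
  annihilator\<close>

lemma null_ideal_scale:
  "a \<in> sl2 \<Longrightarrow> gen (mat k ** a) - scal k * gen a \<in> null_ideal lam"
  by (rule null_ideal_relation) (auto simp: uea_relations_def)

lemma null_ideal_gen_add:
  "a \<in> sl2 \<Longrightarrow> b \<in> sl2 \<Longrightarrow> gen (a + b) - (gen a + gen b) \<in> null_ideal lam"
  by (rule null_ideal_relation) (auto simp: uea_relations_def)

text \<open>Each element of \<open>sl2\<close> is a letter of its own, so even linear dependence
  holds only modulo the relations. The proof telescopes through the partial sums and the scalar
  multiples.\<close>

lemma null_ideal_lincomb:
  assumes "a = mat k ** sl2_h + mat l ** sl2_B + mat m ** sl2_C"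
  shows "gen a - (scal k * gen sl2_h + scal l * gen sl2_B + scal m * gen sl2_C) \<in> null_ideal lam"
proof -
  let ?h = "mat k ** sl2_h" and ?B = "mat l ** sl2_B" and ?C = "mat m ** sl2_C"
  have *: "(g - (g' + c)) + (g' - (h + b)) + (h - h') + (b - b') + (c - c') = g - (h' + b' + c')"
    for g g' h h' b b' c c' :: sl2_free
    by simp
  have "(gen (?h + ?B + ?C) - (gen (?h + ?B) + gen ?C)) + (gen (?h + ?B) - (gen ?h + gen ?B)) +
      (gen ?h - scal k * gen sl2_h) + (gen ?B - scal l * gen sl2_B) + (gen ?C - scal m * gen sl2_C)
      \<in> null_ideal lam"
    by (intro null_ideal_add) (rule null_ideal_gen_add null_ideal_scale; simp)+
  then show ?thesis unfolding assms * .
qed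

lemma null_ideal_bracket:
  assumes "a \<in> sl2" "b \<in> sl2"
    and "lie_bracket a b = mat k ** sl2_h + mat l ** sl2_B + mat m ** sl2_C"
  shows "gen a * gen b - gen b * gen a -
    (scal k * gen sl2_h + scal l * gen sl2_B + scal m * gen sl2_C) \<in> null_ideal lam"
proof -
  have r: "gen a * gen b - gen b * gen a - gen (lie_bracket a b) \<in> null_ideal lam"
    by (rule null_ideal_relation, unfold uea_relations_def) (use assms(1,2) in blast)
  have *: "x - g + (g - s) = x - s" for x g s :: sl2_free by simp
  show ?thesis
    using null_ideal_add[OF r null_ideal_lincomb[OF assms(3)]] unfolding * .
qed

lemma matrix22_eqI:
  fixes A B :: "complex^2^2"
  assumes "A $ 1 $ 1 = B $ 1 $ 1" "A $ 1 $ 2 = B $ 1 $ 2" "A $ 2 $ 1 = B $ 2 $ 1" "A $ 2 $ 2 = B $ 2 $ 2"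
  shows "A = B"
  using assms by (simp add: vec_eq_iff forall_2)

lemma scal_0: "scal 0 = 0"
  by (simp add: scal_def)

lemma scal_uminus: "scal (- k) = - scal k"
  by (simp add: scal_def single_uminus)

lemma scal_diff: "scal (k - l) = scal k - scal l"
  by (simp add: scal_def single_diff)

lemma scal_2: "scal 2 = 2"
  using scal_add[of 1 1] by (simp add: scal_1)

lemma scal_left_commute: "p * (scal k * q) = scal k * (p * q)"
  by (simp only: mult.assoc[symmetric] scal_commute[of k p])

lemma null_ideal_brackets:
  "gen sl2_C * gen sl2_h - gen sl2_h * gen sl2_C + 2 * gen sl2_B \<in> null_ideal lam"
  "gen sl2_C * gen sl2_B - gen sl2_B * gen sl2_C - 2 * gen sl2_h \<in> null_ideal lam"
  "gen sl2_h * gen sl2_B - gen sl2_B * gen sl2_h - 2 * gen sl2_C \<in> null_ideal lam"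
proof -
  note e = sl2_x_def sl2_y_def sl2_h_def sl2_B_def sl2_C_def vector_2 lie_bracket_def
    matrix_matrix_mult_def sum_2 mat_def
  have "lie_bracket sl2_C sl2_h = mat 0 ** sl2_h + mat (- 2) ** sl2_B + mat 0 ** sl2_C"
    "lie_bracket sl2_C sl2_B = mat 2 ** sl2_h + mat 0 ** sl2_B + mat 0 ** sl2_C"
    "lie_bracket sl2_h sl2_B = mat 0 ** sl2_h + mat 0 ** sl2_B + mat 2 ** sl2_C"
    by (rule matrix22_eqI; simp add: e)+
  from this[THEN null_ideal_bracket[rotated 2]]
  show "gen sl2_C * gen sl2_h - gen sl2_h * gen sl2_C + 2 * gen sl2_B \<in> null_ideal lam"
    "gen sl2_C * gen sl2_B - gen sl2_B * gen sl2_C - 2 * gen sl2_h \<in> null_ideal lam"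
    "gen sl2_h * gen sl2_B - gen sl2_B * gen sl2_h - 2 * gen sl2_C \<in> null_ideal lam"
    by (simp_all add: scal_0 scal_uminus scal_2)
qed

lemma null_ideal_casimir_hBC:
  "gen sl2_h * gen sl2_h + gen sl2_B * gen sl2_B - gen sl2_C * gen sl2_C + 1 - scal ((lam + 1)\<^sup>2)
    \<in> null_ideal lam"
proof -
  let ?h = "gen sl2_h" and ?B = "gen sl2_B" and ?C = "gen sl2_C" and ?x = "gen sl2_x" and ?y = "gen sl2_y"
  note e = sl2_x_def sl2_y_def sl2_h_def sl2_B_def sl2_C_def vector_2 matrix_matrix_mult_def sum_2 mat_def
  have "sl2_x = mat 0 ** sl2_h + mat (1 / 2) ** sl2_B + mat (1 / 2) ** sl2_C"
    "sl2_y = mat 0 ** sl2_h + mat (1 / 2) ** sl2_B + mat (- (1 / 2)) ** sl2_C"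
    by (rule matrix22_eqI; simp add: e)+
  from this[THEN null_ideal_lincomb, of lam]
  have x: "?x - scal (1 / 2) * (?B + ?C) \<in> null_ideal lam"
    and y: "?y - scal (1 / 2) * (?B - ?C) \<in> null_ideal lam"
    by (simp_all add: scal_0 scal_uminus algebra_simps)
  have s4: "scal 4 * (scal (1 / 2) * (scal (1 / 2) * p)) = p" for p
    by (simp add: scal_1 flip: mult.assoc scal_mult)
  let ?X = "scal (1 / 2) * (?B + ?C)" and ?Y = "scal (1 / 2) * (?B - ?C)"
  have "?Y * ?X = scal (1 / 2) * (scal (1 / 2) * ((?B - ?C) * (?B + ?C)))"
    by (simp only: mult.assoc scal_left_commute[of "?B - ?C"])
  then have YX: "scal 4 * (?Y * ?X) = (?B - ?C) * (?B + ?C)" by (simp only: s4)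
  \<comment> \<open>The product \<open>y x\<close> is replaced by \<open>Y X\<close> one factor at a
    time, using both sides of the ideal. The last summand cancels the cross terms
    \<open>B C - C B\<close> and the \<open>2 h\<close> coming from
    \<open>(h + 1)^2\<close>.\<close>
  have "casimir_relation lam - scal 4 * (?y * (?x - ?X) + (?y - ?Y) * ?X) +
      (?C * ?B - ?B * ?C - 2 * ?h) \<in> null_ideal lam"
    by (intro null_ideal_add null_ideal_diff null_ideal_mult_left null_ideal_mult_right
        null_ideal_casimir null_ideal_brackets x y) simp_all
  also have "?y * (?x - ?X) + (?y - ?Y) * ?X = ?y * ?x - ?Y * ?X"
    by (simp only: right_diff_distrib left_diff_distrib)  simp
  also have "casimir_relation lam - scal 4 * (?y * ?x - ?Y * ?X) + (?C * ?B - ?B * ?C - 2 * ?h) =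
      (?h + 1)\<^sup>2 - scal ((lam + 1)\<^sup>2) + (?B - ?C) * (?B + ?C) + (?C * ?B - ?B * ?C - 2 * ?h)"
    unfolding casimir_relation_def right_diff_distrib[of "scal 4"] YX by simp
  also have "\<dots> = ?h * ?h + ?B * ?B - ?C * ?C + 1 - scal ((lam + 1)\<^sup>2)"
    by (simp add: power2_eq_square algebra_simps mult_2)
  finally show ?thesis .
qed

subsection \<open>Ladders\<close>

text \<open>Abstract in \<open>X\<close> and \<open>H\<close> because it serves
  \<open>raising\<close> with \<open>weighing\<close> as well as \<open>lowering\<close> with
  \<open>- weighing\<close>. The assumption \<open>H \<in> null lam\<close> says that the class of
  \<open>1\<close> has weight zero.\<close>

lemma ladder_weight:
  assumes X: "X \<in> carrier free_algebra" and H: "H \<in> null lam"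
    and HX: "H * X - X * H - 2 * X \<in> null_ideal lam"
  shows "H * X ^ k - scal (2 * of_nat k) * X ^ k \<in> null lam"
proof (induction k)
  case 0
  then show ?case using H by (simp add: scal_0)
next
  case (Suc k)
  \<comment> \<open>The commutator relation receives a right factor and so must come from
    \<open>null_ideal\<close>; the induction hypothesis is multiplied from the left only.\<close>
  have "(H * X - X * H - 2 * X) * X ^ k + X * (H * X ^ k - scal (2 * of_nat k) * X ^ k) \<in> null lam"
    using X by (intro null_add null_mult Suc null_idealD[OF HX]) simp_all
  also have "(H * X - X * H - 2 * X) * X ^ k + X * (H * X ^ k - scal (2 * of_nat k) * X ^ k) =
      H * X ^ Suc k - scal (2 * of_nat (Suc k)) * X ^ Suc k"
    by (simp add: algebra_simps scal_add scal_2 scal_left_commute[of X])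
  finally show ?case .
qed

text \<open>By \<open>YX\<close> the product \<open>Y X\<close> acts as
  \<open>(lam + 1)^2 - (H + 1)^2\<close>, and \<open>X ^ k\<close> has weight \<open>2 k\<close> for
  \<open>H\<close>.\<close>

lemma ladder_down:
  assumes X: "X \<in> carrier free_algebra" and H: "H \<in> null lam"
    and HX: "H * X - X * H - 2 * X \<in> null_ideal lam"
    and YX: "Y * X + (H + 1) * (H + 1) - scal ((lam + 1)\<^sup>2) \<in> null_ideal lam"
  shows "Y * X ^ Suc k - scal ((lam + 1)\<^sup>2 - (2 * of_nat k + 1)\<^sup>2) * X ^ k \<in> null lam"
proof -
  let ?s = "scal (2 * of_nat k + 1)"
  have "H * X ^ k - scal (2 * of_nat k) * X ^ k \<in> null lam"
    by (rule ladder_weight[OF X H HX])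
  then have w: "(H + 1) * X ^ k - ?s * X ^ k \<in> null lam"
    by (simp add: algebra_simps scal_add scal_1)
  \<comment> \<open>With \<open>s = 2 k + 1\<close>, the subtracted term is
    \<open>(H + 1)^2 - s^2\<close> in the form \<open>(H + 1) (H + 1 - s) + s (H + 1 - s)\<close>,
    applied to \<open>X ^ k\<close>; both parts are left multiples of the known congruence.\<close>
  have "(Y * X + (H + 1) * (H + 1) - scal ((lam + 1)\<^sup>2)) * X ^ k -
      ((H + 1) * ((H + 1) * X ^ k - ?s * X ^ k) + ?s * ((H + 1) * X ^ k - ?s * X ^ k)) \<in> null lam"
    using X null_closed[OF H]
    by (intro null_diff null_add null_mult w null_idealD[OF YX]) simp_all
  also have "(H + 1) * ((H + 1) * X ^ k - ?s * X ^ k) + ?s * ((H + 1) * X ^ k - ?s * X ^ k) =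
      (H + 1) * (H + 1) * X ^ k - ?s * ?s * X ^ k"
    unfolding right_diff_distrib scal_left_commute[of "H + 1"] by (simp add: mult.assoc)
  also have "?s * ?s = scal ((2 * of_nat k + 1)\<^sup>2)"
    by (simp only: power2_eq_square scal_mult)
  also have "(Y * X + (H + 1) * (H + 1) - scal ((lam + 1)\<^sup>2)) * X ^ k -
      ((H + 1) * (H + 1) * X ^ k - scal ((2 * of_nat k + 1)\<^sup>2) * X ^ k) =
      Y * X ^ Suc k - scal ((lam + 1)\<^sup>2 - (2 * of_nat k + 1)\<^sup>2) * X ^ k"
    unfolding scal_diff left_diff_distrib distrib_right[of "Y * X"] by (simp add: mult.assoc)
  finally show ?thesis .
qed

text \<open>The powers are rescaled so that an outward step has the coefficient
  \<open>lam - 2 k\<close>, as on \<open>e_k\<close>. The inverses are genuine when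
  \<open>lam\<close> is not an even integer.\<close>

definition ladder :: "complex \<Rightarrow> sl2_free \<Rightarrow> nat \<Rightarrow> sl2_free" where
  "ladder lam X k = scal (\<Prod>j<k. 1 / (lam - 2 * of_nat j)) * X ^ k"

lemma ladder_0 [simp]: "ladder lam X 0 = 1"
  by (simp add: ladder_def scal_1)

lemma ladder_closed: "X \<in> carrier free_algebra \<Longrightarrow> ladder lam X k \<in> carrier free_algebra"
  by (simp add: ladder_def)

text \<open>Outward steps are exact equations in the free algebra, by the choice of the
  normalisation; inward steps will hold only modulo \<open>null\<close>.\<close>

lemma mult_ladder:
  assumes "lam - 2 * of_nat k \<noteq> 0"
  shows "X * ladder lam X k = scal (lam - 2 * of_nat k) * ladder lam X (Suc k)"
  using assms unfolding ladder_def scal_left_commute[of X]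
  by (simp add: mult.assoc[symmetric] scal_mult[symmetric])

lemma weight_ladder:
  assumes X: "X \<in> carrier free_algebra" and H: "H \<in> null lam"
    and HX: "H * X - X * H - 2 * X \<in> null_ideal lam"
  shows "H * ladder lam X k - scal (2 * of_nat k) * ladder lam X k \<in> null lam"
proof -
  let ?c = "scal (\<Prod>j<k. 1 / (lam - 2 * of_nat j))"
  have "?c * (H * X ^ k - scal (2 * of_nat k) * X ^ k) \<in> null lam"
    by (intro null_mult ladder_weight[OF X H HX]) simp
  also have "?c * (H * X ^ k - scal (2 * of_nat k) * X ^ k) =
      H * (?c * X ^ k) - scal (2 * of_nat k) * (?c * X ^ k)"
    by (simp only: right_diff_distrib scal_left_commute[of H] scal_left_commute[of "scal (2 * of_nat k)"])
  finally show ?thesis by (simp only: ladder_def)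
qed

lemma down_ladder:
  assumes nz: "lam - 2 * of_nat k \<noteq> 0" and X: "X \<in> carrier free_algebra" and H: "H \<in> null lam"
    and HX: "H * X - X * H - 2 * X \<in> null_ideal lam"
    and YX: "Y * X + (H + 1) * (H + 1) - scal ((lam + 1)\<^sup>2) \<in> null_ideal lam"
  shows "Y * ladder lam X (Suc k) - scal (lam + 2 * of_nat k + 2) * ladder lam X k \<in> null lam"
proof -
  let ?d = "\<Prod>j<k. 1 / (lam - 2 * of_nat j)"
  let ?c = "?d / (lam - 2 * of_nat k)"
  have "scal ?c * (Y * X ^ Suc k - scal ((lam + 1)\<^sup>2 - (2 * of_nat k + 1)\<^sup>2) * X ^ k) \<in> null lam"
    by (intro null_mult ladder_down[OF X H HX YX]) simp
  also have "scal ?c * (Y * X ^ Suc k - scal ((lam + 1)\<^sup>2 - (2 * of_nat k + 1)\<^sup>2) * X ^ k) =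
      Y * (scal ?c * X ^ Suc k) - scal (?c * ((lam + 1)\<^sup>2 - (2 * of_nat k + 1)\<^sup>2)) * X ^ k"
    unfolding right_diff_distrib[of "scal ?c" "Y * X ^ Suc k"] scal_left_commute[of Y]
    by (simp only: scal_mult mult.assoc)
  \<comment> \<open>One factor of the difference of squares cancels the new denominator; the other
    is the coefficient of the inward step.\<close>
  also have "?c * ((lam + 1)\<^sup>2 - (2 * of_nat k + 1)\<^sup>2) = (lam + 2 * of_nat k + 2) * ?d"
  proof -
    have "(lam + 1)\<^sup>2 - (2 * of_nat k + 1)\<^sup>2 = (lam - 2 * of_nat k) * (lam + 2 * of_nat k + 2)"
      by (simp add: power2_eq_square algebra_simps)
    then show ?thesis using nz by simp
  qed
  also have "scal ((lam + 2 * of_nat k + 2) * ?d) * X ^ k = scal (lam + 2 * of_nat k + 2) * ladder lam X k"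
    by (simp only: ladder_def scal_mult mult.assoc)
  also have "scal ?c * X ^ Suc k = ladder lam X (Suc k)"
    by (simp add: ladder_def)
  finally show ?thesis .
qed

section \<open>The ladder triple attached to \<open>C\<close>\<close>

definition raising :: sl2_free where
  "raising = gen sl2_h + scal \<i> * gen sl2_B"

definition lowering :: sl2_free where
  "lowering = gen sl2_h - scal \<i> * gen sl2_B"

text \<open>The factor \<open>- \<i>\<close> turns the eigenvalues \<open>2 \<i> n\<close> of
  \<open>C\<close> into \<open>2 n\<close>, and makes \<open>raising\<close> and
  \<open>lowering\<close> eigenvectors of its commutator for \<open>2\<close> and
  \<open>- 2\<close>.\<close>

definition weighing :: sl2_free where
  "weighing = - scal \<i> * gen sl2_C"

lemma raising_etc_closed [simp]:
  "raising \<in> carrier free_algebra" "lowering \<in> carrier free_algebra" "weighing \<in> carrier free_algebra"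
  by (simp_all add: raising_def lowering_def weighing_def)

lemma scal_i_sq: "scal \<i> * (scal \<i> * p) = - p"
  by (simp add: scal_uminus scal_1 flip: mult.assoc scal_mult)

lemma weighing_null: "weighing \<in> null lam"
proof -
  have "gen sl2_C \<in> null lam" by (simp add: null_def MC_of_C)
  then show ?thesis unfolding weighing_def by (intro null_mult) simp_all
qed

text \<open>The first two combine the brackets of \<open>C\<close> with \<open>h\<close> and with
  \<open>B\<close>; the last two are the Casimir relation with \<open>h * h + B * B\<close> replaced
  by a product of ladder elements, at the cost of the bracket of \<open>h\<close> and
  \<open>B\<close>. Exchanging \<open>raising\<close> with \<open>lowering\<close> and negating
  \<open>weighing\<close> swaps the members of each pair.\<close>

lemma sl2_triple_null_ideal:
  "weighing * raising - raising * weighing - 2 * raising \<in> null_ideal lam" (is ?a)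
  "(- weighing) * lowering - lowering * (- weighing) - 2 * lowering \<in> null_ideal lam" (is ?b)
  "lowering * raising + (weighing + 1) * (weighing + 1) - scal ((lam + 1)\<^sup>2) \<in> null_ideal lam" (is ?c)
  "raising * lowering + (- weighing + 1) * (- weighing + 1) - scal ((lam + 1)\<^sup>2) \<in> null_ideal lam" (is ?d)
proof -
  define h B C j where "h = gen sl2_h" and "B = gen sl2_B" and "C = gen sl2_C" and "j = scal \<i>"
  define s where "s = scal ((lam + 1)\<^sup>2)"
  define p q r where "p = C * h - h * C + 2 * B" and "q = C * B - B * C - 2 * h"
    and "r = h * B - B * h - 2 * C"
  define t where "t = h * h + B * B - C * C + 1 - s"
  have null: "p \<in> null_ideal lam" "q \<in> null_ideal lam" "r \<in> null_ideal lam" "t \<in> null_ideal lam"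
    unfolding p_def q_def r_def t_def h_def B_def C_def s_def
    by (rule null_ideal_brackets null_ideal_casimir_hBC)+
  have j: "j \<in> carrier free_algebra" by (simp add: j_def)
  have comm: "h * j = j * h" "B * j = j * B" "C * j = j * C"
    "h * (j * x) = j * (h * x)" "B * (j * x) = j * (B * x)" "C * (j * x) = j * (C * x)" for x
    unfolding j_def by (rule scal_commute[symmetric] scal_left_commute)+
  have jj: "j * (j * x) = - x" for x unfolding j_def by (rule scal_i_sq)
  have X: "raising = h + j * B" and Y: "lowering = h - j * B" and H: "weighing = - (j * C)"
    by (simp_all add: raising_def lowering_def weighing_def h_def B_def C_def j_def)
  have "- (j * p) + q \<in> null_ideal lam"
    by (intro null_ideal_add null_ideal_uminus null_ideal_mult_left null j)
  also have "- (j * p) + q = weighing * raising - raising * weighing - 2 * raising"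
    unfolding X H p_def q_def by (simp add: algebra_simps comm jj mult_2)
  finally show ?a .
  have "j * p + q \<in> null_ideal lam"
    by (intro null_ideal_add null_ideal_uminus null_ideal_mult_left null j)
  also have "j * p + q = (- weighing) * lowering - lowering * (- weighing) - 2 * lowering"
    unfolding Y H p_def q_def by (simp add: algebra_simps comm jj mult_2)
  finally show ?b .
  have "t + j * r \<in> null_ideal lam"
    by (intro null_ideal_add null_ideal_mult_left null j)
  also have "t + j * r = lowering * raising + (weighing + 1) * (weighing + 1) - scal ((lam + 1)\<^sup>2)"
    unfolding X Y H t_def r_def s_def[symmetric] by (simp add: algebra_simps comm jj mult_2)
  finally show ?c .
  have "t - j * r \<in> null_ideal lam"
    by (intro null_ideal_diff null_ideal_mult_left null j)
  also have "t - j * r = raising * lowering + (- weighing + 1) * (- weighing + 1) - scal ((lam + 1)\<^sup>2)"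
    unfolding X Y H t_def r_def s_def[symmetric] by (simp add: algebra_simps comm jj mult_2)
  finally show ?d .
qed

definition weight_vector :: "complex \<Rightarrow> int \<Rightarrow> sl2_free" where
  "weight_vector lam n =
    (if n \<ge> 0 then ladder lam raising (nat n) else ladder lam lowering (nat (- n)))"

lemma weight_vector_closed [simp]: "weight_vector lam n \<in> carrier free_algebra"
  by (simp add: weight_vector_def ladder_closed)

lemma weight_vector_nonneg: "weight_vector lam (int k) = ladder lam raising k"
  by (simp add: weight_vector_def)

text \<open>Includes \<open>k = 0\<close>, where both ladders start at \<open>1\<close>; inward
  steps that end at weight zero rely on this.\<close>

lemma weight_vector_nonpos: "weight_vector lam (- int k) = ladder lam lowering k"
  by (cases "k = 0") (simp_all add: weight_vector_def)

lemma int_sign_cases: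
  obtains k where "n = int k" | k where "n = - int (Suc k)"
  by (metis int_cases)

text \<open>For \<open>n \<ge> 0\<close> this is an outward step on the \<open>raising\<close>
  ladder; for \<open>n < 0\<close> it is an inward step on the \<open>lowering\<close> ladder, whose
  coefficient comes from the Casimir relation.\<close>

lemma raising_weight_vector:
  assumes nz: "\<And>n :: int. lam - 2 * of_int n \<noteq> 0"
  shows "raising * weight_vector lam n - scal (lam - 2 * of_int n) * weight_vector lam (n + 1) \<in> null lam"
proof (cases n rule: int_sign_cases)
  case (1 k)
  have "n + 1 = int (Suc k)" using 1 by simp
  moreover have "raising * ladder lam raising k = scal (lam - 2 * of_nat k) * ladder lam raising (Suc k)"
    by (rule mult_ladder) (use nz[of "int k"] in simp)
  ultimately show ?thesis
    unfolding 1 by (simp only: weight_vector_nonneg of_int_of_nat_eq) simp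
next
  case (2 k)
  have n: "n + 1 = - int k" using 2 by simp
  have c: "lam - 2 * of_int n = lam + 2 * of_nat k + 2" using 2 by simp
  have "lam - 2 * of_nat k \<noteq> 0" using nz[of "int k"] by simp
  from down_ladder[OF this _ null_uminus[OF weighing_null] sl2_triple_null_ideal(2,4)]
  show ?thesis unfolding n c unfolding 2 weight_vector_nonpos by simp
qed

lemma lowering_weight_vector:
  assumes nz: "\<And>n :: int. lam - 2 * of_int n \<noteq> 0"
  shows "lowering * weight_vector lam n - scal (lam + 2 * of_int n) * weight_vector lam (n - 1) \<in> null lam"
proof (cases "- n" rule: int_sign_cases)
  \<comment> \<open>The split is on \<open>- n\<close>, so weight zero counts as the start of an
    outward step here.\<close>
  case (1 k)
  have n: "n = - int k" "n - 1 = - int (Suc k)" using 1 by simp_all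
  have c: "lam + 2 * of_int n = lam - 2 * of_nat k" using n by simp
  have "lowering * ladder lam lowering k = scal (lam - 2 * of_nat k) * ladder lam lowering (Suc k)"
    by (rule mult_ladder) (use nz[of "int k"] in simp)
  then show ?thesis
    unfolding c n(2) unfolding n(1) by (simp only: weight_vector_nonpos) simp
next
  case (2 k)
  have n: "n = int (Suc k)" "n - 1 = int k" using 2 by simp_all
  have c: "lam + 2 * of_int n = lam + 2 * of_nat k + 2" using n(1) by (simp add: algebra_simps)
  have "lam - 2 * of_nat k \<noteq> 0" using nz[of "int k"] by simp
  from down_ladder[OF this _ weighing_null sl2_triple_null_ideal(1,3)]
  show ?thesis unfolding c n(2) unfolding n(1) weight_vector_nonneg by simp
qed

lemma weighing_weight_vector:
  "weighing * weight_vector lam n - scal (2 * of_int n) * weight_vector lam n \<in> null lam"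
proof (cases n rule: int_sign_cases)
  case (1 k)
  show ?thesis
    unfolding 1 weight_vector_nonneg of_int_of_nat_eq
    by (rule weight_ladder[OF _ weighing_null sl2_triple_null_ideal(1)]) simp
next
  case (2 k)
  have "(- weighing) * ladder lam lowering (Suc k) - scal (2 * of_nat (Suc k)) * ladder lam lowering (Suc k) \<in> null lam"
    by (rule weight_ladder[OF _ null_uminus[OF weighing_null] sl2_triple_null_ideal(2)]) simp
  from null_uminus[OF this] have "weighing * ladder lam lowering (Suc k) -
      scal (- (2 * of_nat (Suc k))) * ladder lam lowering (Suc k) \<in> null lam"
    unfolding scal_uminus by (simp add: add.commute)
  moreover have "2 * of_int n = - (2 * of_nat (Suc k) :: complex)" using 2 by simp
  ultimately show ?thesis unfolding 2[symmetric] by (simp only: 2 weight_vector_nonpos)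
qed

section \<open>The linear lift of the weight module to the free algebra\<close>

definition lift :: "complex \<Rightarrow> weight_space \<Rightarrow> sl2_free" where
  "lift lam v = (\<Sum>n\<in>Poly_Mapping.keys v. scal (coef v n) * weight_vector lam n)"

lemma lift_superset:
  "finite S \<Longrightarrow> Poly_Mapping.keys v \<subseteq> S \<Longrightarrow>
    lift lam v = (\<Sum>n\<in>S. scal (coef v n) * weight_vector lam n)"
  unfolding lift_def by (rule sum.mono_neutral_left) (auto simp: in_keys_iff scal_0)

lemma lift_closed [simp]: "lift lam v \<in> carrier free_algebra"
  by (simp add: lift_def)

lemma lift_add: "lift lam (u + v) = lift lam u + lift lam v"
proof -
  let ?S = "Poly_Mapping.keys u \<union> Poly_Mapping.keys v"
  have "Poly_Mapping.keys (u + v) \<subseteq> ?S" by (rule keys_add)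
  then show ?thesis
    by (simp add: lift_superset[of ?S] lookup_add scal_add distrib_right sum.distrib)
qed

lemma lift_0 [simp]: "lift lam 0 = 0"
  by (simp add: lift_def)

lemma lift_scale: "lift lam (wscale c v) = scal c * lift lam v"
proof -
  have "Poly_Mapping.keys (wscale c v) \<subseteq> Poly_Mapping.keys v"
    by (auto simp: in_keys_iff wscale.rep_eq)
  then show ?thesis
    by (simp add: lift_superset[of "Poly_Mapping.keys v"] wscale.rep_eq scal_mult sum_distrib_left mult.assoc)
qed

lemma lift_sum: "lift lam (\<Sum>i\<in>A. f i) = (\<Sum>i\<in>A. lift lam (f i))"
  by (induction A rule: infinite_finite_induct) (auto simp: lift_add)

lemma lift_basis_vec: "lift lam (basis_vec n) = weight_vector lam n"
  by (simp add: lift_superset[of "{n}"] basis_vec_def scal_1)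

lemma lift_uminus: "lift lam (- v) = - lift lam v"
  using lift_add[of lam v "- v"] by (simp add: add_eq_0_iff)

lemma lift_diff: "lift lam (u - v) = lift lam u - lift lam v"
  using lift_add[of lam u "- v"] by (simp add: lift_uminus)

text \<open>With \<open>X\<close>, \<open>Y\<close>, \<open>H\<close> for \<open>raising\<close>,
  \<open>lowering\<close>, \<open>weighing\<close>, the generators are
  \<open>h = (X + Y) / 2\<close>, \<open>B = \<i> (Y - X) / 2\<close> and \<open>C = \<i> H\<close>,
  so the claims are combinations of the three ladder congruences \<open>x\<close>, \<open>y\<close>,
  \<open>z\<close>.\<close>

lemma lift_wact_basis_vec:
  assumes nz: "\<And>n :: int. lam - 2 * of_int n \<noteq> 0"
  shows "gen sl2_h * weight_vector lam n - lift lam (wact (lam / 2) sl2_h (basis_vec n)) \<in> null lam"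
    "gen sl2_B * weight_vector lam n - lift lam (wact (lam / 2) sl2_B (basis_vec n)) \<in> null lam"
    "gen sl2_C * weight_vector lam n - lift lam (wact (lam / 2) sl2_C (basis_vec n)) \<in> null lam"
proof -
  define w u d where "w = weight_vector lam n" and "u = weight_vector lam (n + 1)"
    and "d = weight_vector lam (n - 1)"
  define x where "x = raising * w - scal (lam - 2 * of_int n) * u"
  define y where "y = lowering * w - scal (lam + 2 * of_int n) * d"
  define z where "z = weighing * w - scal (2 * of_int n) * w"
  have null: "x \<in> null lam" "y \<in> null lam" "z \<in> null lam"
    unfolding x_def y_def z_def w_def u_def d_def
    by (intro raising_weight_vector lowering_weight_vector weighing_weight_vector nz)+
  have half: "scal (1 / 2) * (p + p) = p" for p
    by (simp add: distrib_left scal_1 flip: distrib_right scal_add)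
  have u: "scal (1 / 2) * (scal (lam - 2 * of_int n) * u) = scal (lam / 2 - of_int n) * u"
    and d: "scal (1 / 2) * (scal (lam + 2 * of_int n) * d) = scal (lam / 2 + of_int n) * d"
    by (simp_all add: field_simps flip: mult.assoc scal_mult)
  have "scal (1 / 2) * (x + y) \<in> null lam" by (intro null_mult null_add null) simp
  also have "x + y = (gen sl2_h * w + gen sl2_h * w) -
      (scal (lam - 2 * of_int n) * u + scal (lam + 2 * of_int n) * d)"
    by (simp add: x_def y_def raising_def lowering_def algebra_simps)
  also have "scal (1 / 2) * \<dots> = gen sl2_h * w - (scal (lam / 2 - of_int n) * u + scal (lam / 2 + of_int n) * d)"
    unfolding right_diff_distrib half distrib_left[of "scal (1 / 2)" "scal (lam - 2 * of_int n) * u"] u d ..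
  also have "scal (lam / 2 - of_int n) * u + scal (lam / 2 + of_int n) * d =
      lift lam (wact (lam / 2) sl2_h (basis_vec n))"
    by (simp add: wact_sl2_h raise_basis_vec lower_basis_vec lift_add lift_scale lift_basis_vec u_def d_def)
  finally show "gen sl2_h * weight_vector lam n - lift lam (wact (lam / 2) sl2_h (basis_vec n)) \<in> null lam"
    unfolding w_def .
  have "scal \<i> * (scal (1 / 2) * (y - x)) \<in> null lam" by (intro null_mult null_diff null) simp_all
  also have "y - x = - (scal \<i> * (gen sl2_B * w) + scal \<i> * (gen sl2_B * w)) +
      (scal (lam - 2 * of_int n) * u - scal (lam + 2 * of_int n) * d)"
    by (simp add: x_def y_def raising_def lowering_def algebra_simps)
  also have "scal (1 / 2) * \<dots> = - (scal \<i> * (gen sl2_B * w)) +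
      (scal (lam / 2 - of_int n) * u - scal (lam / 2 + of_int n) * d)"
    unfolding distrib_left[of "scal (1 / 2)" "- _"] mult_minus_right half
      right_diff_distrib[of "scal (1 / 2)"] u d ..
  also have "scal \<i> * \<dots> = gen sl2_B * w -
      scal \<i> * (scal (lam / 2 + of_int n) * d - scal (lam / 2 - of_int n) * u)"
    unfolding distrib_left[of "scal \<i>" "- _"] mult_minus_right scal_i_sq right_diff_distrib[of "scal \<i>"]
    by simp
  also have "scal \<i> * (scal (lam / 2 + of_int n) * d - scal (lam / 2 - of_int n) * u) =
      lift lam (wact (lam / 2) sl2_B (basis_vec n))"
    unfolding wact_sl2_B raise_basis_vec lower_basis_vec lift_diff lift_scale lift_basis_vec u_def d_def ..
  finally show "gen sl2_B * weight_vector lam n - lift lam (wact (lam / 2) sl2_B (basis_vec n)) \<in> null lam"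
    unfolding w_def .
  have "scal \<i> * z \<in> null lam" by (intro null_mult null) simp
  also have "scal \<i> * z = gen sl2_C * w - scal \<i> * (scal (2 * of_int n) * w)"
    by (simp add: z_def weighing_def right_diff_distrib scal_i_sq mult.assoc)
  also have "scal \<i> * (scal (2 * of_int n) * w) = lift lam (wact (lam / 2) sl2_C (basis_vec n))"
    unfolding wact_sl2_C weight_basis_vec lift_scale lift_basis_vec w_def
    by (simp add: mult_ac flip: mult.assoc[where 'a = sl2_free] scal_mult)
  finally show "gen sl2_C * weight_vector lam n - lift lam (wact (lam / 2) sl2_C (basis_vec n)) \<in> null lam"
    unfolding w_def .
qed

lemma lift_wact_generator:
  assumes "\<And>n. gen a * weight_vector lam n - lift lam (wact (lam / 2) a (basis_vec n)) \<in> null lam"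
  shows "gen a * lift lam v - lift lam (wact (lam / 2) a v) \<in> null lam"
proof -
  have "(\<Sum>n\<in>Poly_Mapping.keys v. scal (coef v n) *
      (gen a * weight_vector lam n - lift lam (wact (lam / 2) a (basis_vec n)))) \<in> null lam"
    by (intro null_sum null_mult assms) simp
  also have "(\<Sum>n\<in>Poly_Mapping.keys v. scal (coef v n) *
      (gen a * weight_vector lam n - lift lam (wact (lam / 2) a (basis_vec n)))) =
      gen a * lift lam v - lift lam (wact (lam / 2) a (\<Sum>n\<in>Poly_Mapping.keys v. wscale (coef v n) (basis_vec n)))"
    by (simp add: lift_def[of lam v] wact_sum lift_sum wact_scale_right lift_scale sum_distrib_left
        right_diff_distrib sum_subtractf scal_left_commute[of "gen a"])
  finally show ?thesis by (simp flip: weight_expansion)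
qed

lemma sl2_decomposition:
  assumes "a \<in> sl2"
  shows "a = mat (a $ 1 $ 1) ** sl2_h + mat ((a $ 1 $ 2 + a $ 2 $ 1) / 2) ** sl2_B +
    mat ((a $ 1 $ 2 - a $ 2 $ 1) / 2) ** sl2_C"
  using assms
  by (intro matrix22_eqI; simp add: sl2_iff mat_mult_nth sl2_h_def sl2_B_def sl2_C_def sl2_x_def sl2_y_def
      vector_2 field_simps)

lemma lift_wact:
  assumes nz: "\<And>n :: int. lam - 2 * of_int n \<noteq> 0" and a: "a \<in> sl2"
  shows "gen a * lift lam v - lift lam (wact (lam / 2) a v) \<in> null lam"
proof -
  define k l m where "k = a $ 1 $ 1" and "l = (a $ 1 $ 2 + a $ 2 $ 1) / 2" and "m = (a $ 1 $ 2 - a $ 2 $ 1) / 2"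
  let ?h = "gen sl2_h" and ?B = "gen sl2_B" and ?C = "gen sl2_C"
  let ?w = "\<lambda>b. lift lam (wact (lam / 2) b v)"
  have null: "?h * lift lam v - ?w sl2_h \<in> null lam" "?B * lift lam v - ?w sl2_B \<in> null lam"
    "?C * lift lam v - ?w sl2_C \<in> null lam"
    by (rule lift_wact_generator, rule lift_wact_basis_vec[OF nz])+
  have "gen a - (scal k * ?h + scal l * ?B + scal m * ?C) \<in> null_ideal lam"
    unfolding k_def l_def m_def by (rule null_ideal_lincomb[OF sl2_decomposition[OF a]])
  then have "(gen a - (scal k * ?h + scal l * ?B + scal m * ?C)) * lift lam v +
      (scal k * (?h * lift lam v - ?w sl2_h) + scal l * (?B * lift lam v - ?w sl2_B) +
       scal m * (?C * lift lam v - ?w sl2_C)) \<in> null lam"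
    by (intro null_add null_idealD null_mult null) simp_all
  also have "(gen a - (scal k * ?h + scal l * ?B + scal m * ?C)) * lift lam v +
      (scal k * (?h * lift lam v - ?w sl2_h) + scal l * (?B * lift lam v - ?w sl2_B) +
       scal m * (?C * lift lam v - ?w sl2_C)) =
      gen a * lift lam v - (scal k * ?w sl2_h + scal l * ?w sl2_B + scal m * ?w sl2_C)"
    by (simp add: algebra_simps)
  also have "scal k * ?w sl2_h + scal l * ?w sl2_B + scal m * ?w sl2_C = ?w a"
    unfolding k_def l_def m_def wact_generators[of _ a v] by (simp only: lift_add lift_scale)
  finally show ?thesis .
qed

text \<open>Words are built from the right: the empty word matches
  \<open>weight_vector lam 0 = 1\<close>, and each further letter is multiplied from the left, which
  \<open>null\<close> permits. Hence a coset is determined by the value of a representative at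
  \<open>basis_vec 0\<close>.\<close>

lemma lift_evaluate:
  assumes nz: "\<And>n :: int. lam - 2 * of_int n \<noteq> 0" and p: "p \<in> carrier free_algebra"
  shows "p - lift lam (evaluate (lam / 2) p (basis_vec 0)) \<in> null lam"
proof -
  have word: "Poly_Mapping.single w 1 - lift lam (foldr (wact (lam / 2)) w (basis_vec 0)) \<in> null lam"
    if "set w \<subseteq> sl2" for w
    using that
  proof (induction w)
    case Nil
    have "Poly_Mapping.single [] 1 = (1 :: sl2_free)" using scal_1 by (simp add: scal_def)
    then show ?case by (simp add: lift_basis_vec weight_vector_def)
  next
    case (Cons a w)
    let ?u = "foldr (wact (lam / 2)) w (basis_vec 0)"
    have "gen a * (Poly_Mapping.single w 1 - lift lam ?u) +
        (gen a * lift lam ?u - lift lam (wact (lam / 2) a ?u)) \<in> null lam"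
      using Cons by (intro null_add null_mult lift_wact nz) simp_all
    moreover have "gen a * Poly_Mapping.single w 1 = Poly_Mapping.single (a # w) 1"
      by (simp add: gen_def mult_single plus_list_def)
    ultimately show ?case by (simp add: right_diff_distrib)
  qed
  have "(\<Sum>w\<in>Poly_Mapping.keys p. scal (coef p w) *
      (Poly_Mapping.single w 1 - lift lam (foldr (wact (lam / 2)) w (basis_vec 0)))) \<in> null lam"
    by (intro null_sum null_mult word scal_closed) (use p in \<open>simp add: free_algebra_carrier\<close>)
  also have "(\<Sum>w\<in>Poly_Mapping.keys p. scal (coef p w) *
      (Poly_Mapping.single w 1 - lift lam (foldr (wact (lam / 2)) w (basis_vec 0)))) =
      (\<Sum>w\<in>Poly_Mapping.keys p. Poly_Mapping.single w (coef p w)) -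
      lift lam (evaluate (lam / 2) p (basis_vec 0))"
    by (simp add: evaluate_def lift_sum lift_scale right_diff_distrib sum_subtractf scal_mult_single)
  finally show ?thesis by (simp flip: poly_mapping_expansion)
qed

section \<open>The identification of the coset module with the weight module\<close>

lemma evaluate_surj:
  assumes "\<mu> \<notin> \<int>"
  shows "\<exists>p\<in>carrier free_algebra. v = evaluate \<mu> p (basis_vec 0)"
proof -
  let ?S = "(\<lambda>p. evaluate \<mu> p (basis_vec 0)) ` carrier free_algebra"
  have "invariant_subspace \<mu> ?S"
    unfolding invariant_subspace_def
  proof (intro conjI ws.subspaceI ballI)
    show "0 \<in> ?S" by (intro image_eqI[of _ _ 0]) simp_all
  next
    fix u w assume "u \<in> ?S" "w \<in> ?S"
    then obtain p q where "p \<in> carrier free_algebra" "q \<in> carrier free_algebra"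
      "u = evaluate \<mu> p (basis_vec 0)" "w = evaluate \<mu> q (basis_vec 0)" by blast
    then show "u + w \<in> ?S" by (intro image_eqI[of _ _ "p + q"]) (simp_all add: evaluate_add)
  next
    fix c u assume "u \<in> ?S"
    then obtain p where "p \<in> carrier free_algebra" "u = evaluate \<mu> p (basis_vec 0)" by blast
    then show "wscale c u \<in> ?S" by (intro image_eqI[of _ _ "scal c * p"]) (simp_all add: evaluate_mult)
  next
    fix a u assume "a \<in> sl2" "u \<in> ?S"
    then obtain p where "p \<in> carrier free_algebra" "u = evaluate \<mu> p (basis_vec 0)" by blast
    then show "wact \<mu> a u \<in> ?S"
      using \<open>a \<in> sl2\<close> by (intro image_eqI[of _ _ "gen a * p"]) (simp_all add: evaluate_mult)
  qed
  moreover have "basis_vec 0 \<in> ?S" by (intro image_eqI[of _ _ 1]) simp_all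
  moreover have "basis_vec 0 \<noteq> 0" by (simp add: basis_vec_def)
  ultimately have "?S = UNIV" by (rule invariant_subspace_eq_UNIV[OF assms])
  then show ?thesis by blast
qed

lemma half_not_Ints_iff:
  fixes lam :: complex
  shows "lam / 2 \<notin> \<int> \<longleftrightarrow> lam \<notin> {2 * of_int k | k :: int. True}"
  by (auto simp: Ints_def field_simps)

definition coset_of :: "complex \<Rightarrow> weight_space \<Rightarrow> sl2_free set set set" where
  "coset_of lam v = MC_of lam (lift lam v)"

lemma MC_of_eq_coset_of:
  assumes "lam / 2 \<notin> \<int>" "p \<in> carrier free_algebra"
  shows "MC_of lam p = coset_of lam (evaluate (lam / 2) p (basis_vec 0))"
proof -
  have "lam - 2 * of_int n \<noteq> 0" for n :: int
    using assms(1) unfolding half_not_Ints_iff by auto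
  then show ?thesis
    unfolding coset_of_def using assms(2) by (intro MC_of_eq_null lift_evaluate lift_closed)
qed

lemma weight_space_copy_MC:
  assumes "lam / 2 \<notin> \<int>"
  shows "weight_space_copy (lam / 2) (MC lam) (MC_act lam) (coset_of lam)"
proof
  note eq = MC_of_eq_coset_of[OF assms]
  show "carrier (MC lam) = range (coset_of lam)"
    unfolding MC_carrier
  proof (intro equalityI image_subsetI)
    show "MC_of lam p \<in> range (coset_of lam)" if "p \<in> carrier free_algebra" for p
      unfolding eq[OF that] by (rule rangeI)
    show "coset_of lam v \<in> MC_of lam ` carrier free_algebra" for v
      unfolding coset_of_def by (rule imageI) simp
  qed
  show "inj (coset_of lam)"
  proof (rule injI)
    fix u v assume uv: "coset_of lam u = coset_of lam v"
    \<comment> \<open>Preimages under the surjective evaluation replace the lifted vectors, so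
      injectivity follows from well-definedness on cosets without evaluating any ladder.\<close>
    obtain p q where pq: "p \<in> carrier free_algebra" "q \<in> carrier free_algebra"
      and u: "u = evaluate (lam / 2) p (basis_vec 0)" and v: "v = evaluate (lam / 2) q (basis_vec 0)"
      using evaluate_surj[OF assms] by meson
    have "MC_of lam p = MC_of lam q"
      using uv unfolding eq[OF pq(1)] eq[OF pq(2)] u v .
    then show "u = v" unfolding u v using pq by (rule MC_of_eqD)
  qed
  show "\<zero>\<^bsub>MC lam\<^esub> = coset_of lam 0"
    by (simp add: coset_of_def MC_zero)
  show "coset_of lam u \<oplus>\<^bsub>MC lam\<^esub> coset_of lam v = coset_of lam (u + v)" for u v
    by (simp add: coset_of_def MC_add lift_add)
  show "c \<odot>\<^bsub>MC lam\<^esub> coset_of lam v = coset_of lam (wscale c v)" for c v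
    by (simp add: coset_of_def MC_smult lift_scale)
  show "MC_act lam a (coset_of lam v) = coset_of lam (wact (lam / 2) a v)" if a: "a \<in> sl2" for a v
  proof -
    \<comment> \<open>On the coset of a preimage \<open>p\<close> the action is left multiplication
      by a letter, which evaluation turns into \<open>wact\<close>.\<close>
    obtain p where p: "p \<in> carrier free_algebra" "v = evaluate (lam / 2) p (basis_vec 0)"
      using evaluate_surj[OF assms] by meson
    have "MC_act lam a (coset_of lam v) = MC_of lam (gen a * p)"
      unfolding p(2) eq[OF p(1), symmetric] by (rule MC_act_of[OF a p(1)])
    also have "\<dots> = coset_of lam (wact (lam / 2) a v)"
      using a p by (simp add: eq evaluate_mult)
    finally show ?thesis .
  qed
qed

lemma MC_component_eq:
  assumes "lam / 2 \<notin> \<int>"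
  shows "MC_component lam g =
    coset_of lam ` (\<lambda>p. evaluate (lam / 2) p (basis_vec 0)) ` free_component g"
  unfolding MC_component_def uea_component_def image_image
proof (rule image_cong[OF refl])
  fix p assume "p \<in> free_component g"
  then have p: "p \<in> carrier free_algebra" using free_component_closed by blast
  show "MC_class lam (U_I_class lam (uea_class p)) =
      coset_of lam (evaluate (lam / 2) p (basis_vec 0))"
    unfolding MC_of_eq_coset_of[OF assms p, symmetric] MC_of_def U_I_of_def ..
qed

theorem corollary3p10:
  fixes lam :: complex
  assumes "lam \<notin> {2 * of_int k | k :: int. True}"
  shows "simple_sl2_module (MC lam) (MC_act lam) \<and>
    graded_sl2_module (MC lam) (MC_act lam) (MC_component lam) \<and>
    sl2_module_rank (MC lam) (MC_act lam) 2"
proof -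
  have \<mu>: "lam / 2 \<notin> \<int>" by (rule half_not_Ints_iff[THEN iffD2, OF assms])
  interpret weight_space_copy "lam / 2" "MC lam" "MC_act lam" "coset_of lam"
    by (rule weight_space_copy_MC[OF \<mu>])
  let ?N = "\<lambda>g. (\<lambda>p. evaluate (lam / 2) p (basis_vec 0)) ` free_component g"
  have "graded_sl2_module (MC lam) (MC_act lam) (MC_component lam)"
  proof (rule graded[OF \<mu>, of ?N])
    show "basis_vec 0 \<in> ?N 0"
      by (intro image_eqI[of _ _ 1] one_in_free_component) simp
    show "?N g \<subseteq> weight_component g" for g
      using evaluate_free_component by blast
  qed (rule subspace_evaluate_free_component wact_evaluate_free_component MC_component_eq[OF \<mu>]; assumption?)+
  then show ?thesis using simple[OF \<mu>] rank_2[OF \<mu>] by blast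
qed

end
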